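(* We have \[ \sum_{n=0}^{\infty}b_9(4n+3)q^{n}=3\,\frac{f_2^{2}f_6^{2}f_9}{f_1^{5}} . \] In particular $b_9(4n+3)\equiv 0\pmod 3$ for all $n\ge0$.
   Context: $b_9(n)$ is the number of partitions of $n$ none of whose parts is divisible by $9$; equivalently $\sum_{n\ge0}b_9(n)q^n=f_9/f_1$, where $f_k=\prod_{j\ge1}(1-q^{jk})$. *)

theory Defs
  imports
    "HOL-Analysis.Analysis"
    "HOL-Number_Theory.Cong"
    "HOL-Library.Multiset"
begin

text \<open>A partition is the multiset of its (positive) parts; \<open>b_reg m n\<close> counts the partitions
  of \<open>n\<close> none of whose parts is divisible by \<open>m\<close>.\<close>

definition regular_partitions :: "nat \<Rightarrow> nat \<Rightarrow> nat multiset set" where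
  "regular_partitions m n = {P. (\<forall>k \<in># P. 0 < k) \<and> sum_mset P = n \<and> (\<forall>k \<in># P. \<not> m dvd k)}"

definition b_reg :: "nat \<Rightarrow> nat \<Rightarrow> nat" where
  "b_reg m n = card (regular_partitions m n)"

lemma finite_regular_partitions: "finite (regular_partitions m n)"
proof -
  have size: "size P \<le> sum_mset P" if "\<forall>k \<in># P. 0 < k" for P :: "nat multiset"
    using that by (induction P) auto
  have part: "k \<le> sum_mset P" if "k \<in># P" for k and P :: "nat multiset"
    using that by (metis le_add1 multi_member_split sum_mset.add_mset)
  have "regular_partitions m n \<subseteq> mset ` {xs. set xs \<subseteq> {..n} \<and> length xs \<le> n}"
  proof
    fix P assume "P \<in> regular_partitions m n"
    hence P: "size P \<le> n" "set_mset P \<subseteq> {..n}"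
      using size[of P] part[of _ P] unfolding regular_partitions_def by blast+
    obtain xs where xs: "mset xs = P"
      using ex_mset by blast
    have "set xs \<subseteq> {..n} \<and> length xs \<le> n"
      using P unfolding xs[symmetric] set_mset_mset size_mset by blast
    thus "P \<in> mset ` {xs. set xs \<subseteq> {..n} \<and> length xs \<le> n}"
      using xs by blast
  qed
  thus ?thesis
    by (rule finite_subset) (intro finite_imageI finite_lists_length_le finite_atMost)
qed

text \<open>The infinite product is a limit in the metric space of formal power series,
  i.e. coefficientwise; lemma \<open>euler_f_has_prod\<close> shows that it exists. \<open>prodinf\<close> starts at
  index 0, hence the shift to \<open>Suc j\<close>. The coefficients are rational so that quotients of
  series are available; every \<open>euler_f k\<close> with \<open>0 < k\<close> is a unit by \<open>euler_f_nth_0\<close>.\<close>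

definition euler_f :: "nat \<Rightarrow> rat fps" where
  "euler_f k = (\<Prod>j. 1 - fps_X ^ (Suc j * k))"

lemma euler_f_partial_nth:
  assumes "0 < k" "n \<le> N"
  shows "fps_nth (\<Prod>j\<le>N. 1 - fps_X ^ (Suc j * k) :: rat fps) n
    = fps_nth (\<Prod>j\<le>n. 1 - fps_X ^ (Suc j * k)) n"
  using assms(2)
proof (induction N rule: dec_induct)
  case (step N)
  have "n < Suc (Suc N) * 1"
    using \<open>n \<le> N\<close> by simp
  also have "\<dots> \<le> Suc (Suc N) * k"
    using \<open>0 < k\<close> by (intro mult_le_mono2) simp
  finally have n: "n < Suc (Suc N) * k" .
  let ?Q = "\<Prod>j\<le>N. 1 - fps_X ^ (Suc j * k) :: rat fps"
  have "(\<Prod>j\<le>Suc N. 1 - fps_X ^ (Suc j * k) :: rat fps) = ?Q - ?Q * fps_X ^ (Suc (Suc N) * k)"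
    unfolding prod.atMost_Suc by (simp only: right_diff_distrib mult_1_right)
  moreover have "fps_nth (?Q * fps_X ^ (Suc (Suc N) * k)) n = 0"
    unfolding fps_X_power_mult_right_nth by (rule if_P[OF n])
  ultimately have "fps_nth (\<Prod>j\<le>Suc N. 1 - fps_X ^ (Suc j * k) :: rat fps) n = fps_nth ?Q n"
    by (simp only: fps_sub_nth diff_0_right)
  thus ?case
    using step.IH by (rule trans)
qed (rule refl)

lemma euler_f_aux:
  assumes "0 < k"
  defines "P \<equiv> Abs_fps (\<lambda>n. fps_nth (\<Prod>j\<le>n. 1 - fps_X ^ (Suc j * k) :: rat fps) n)"
  shows "(\<lambda>j. 1 - fps_X ^ (Suc j * k) :: rat fps) has_prod P" and "fps_nth P 0 = 1"
proof -
  show P0: "fps_nth P 0 = 1"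
    using assms(1) by (simp add: P_def)
  have "(\<lambda>N. \<Prod>j\<le>N. 1 - fps_X ^ (Suc j * k) :: rat fps) \<longlonglongrightarrow> P"
  proof (rule tendsto_fpsI)
    fix n
    show "\<forall>\<^sub>F N in sequentially. fps_nth (\<Prod>j\<le>N. 1 - fps_X ^ (Suc j * k) :: rat fps) n = fps_nth P n"
      using eventually_ge_at_top[of n]
      by eventually_elim (unfold P_def fps_nth_Abs_fps, rule euler_f_partial_nth[OF assms(1)])
  qed
  moreover have "P \<noteq> 0"
    using P0 by auto
  ultimately show "(\<lambda>j. 1 - fps_X ^ (Suc j * k) :: rat fps) has_prod P"
    by (simp add: has_prod_def raw_has_prod_def)
qed

lemma euler_f_has_prod:
  assumes "0 < k"
  shows "(\<lambda>j. 1 - fps_X ^ (Suc j * k)) has_prod euler_f k"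
  unfolding euler_f_def has_prod_unique[OF euler_f_aux(1)[OF assms], symmetric]
  by (rule euler_f_aux(1)[OF assms])

lemma euler_f_nth_0:
  assumes "0 < k"
  shows "fps_nth (euler_f k) 0 = 1"
  unfolding euler_f_def has_prod_unique[OF euler_f_aux(1)[OF assms], symmetric]
  by (rule euler_f_aux(2)[OF assms])

end

theory Submission
  imports Defs
begin

text \<open>Write \<open>c = f\<^sub>3\<^sup>3/f\<^sub>1\<close> and \<open>\<psi> = f\<^sub>2\<^sup>2/f\<^sub>1\<close>. The constant term in \<open>z\<close> of a product of three Jacobi
  triple products gives \<open>c\<close> as a sum of \<open>q\<close> to the power \<open>3b\<^sup>2 + 3bc + 3c\<^sup>2 + b + 2c\<close> over all integers
  \<open>b, c\<close>, whence \<open>c = E + O\<close> with \<open>O(q) = q c(q\<^sup>4)\<close> odd and \<open>E\<close> even. The 3-dissection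
  \<open>\<psi>(q) = A(q\<^sup>3) + q \<psi>(q\<^sup>9)\<close> has two uses. Its norm over the cube roots of unity is the level 6 identity
  \<open>f\<^sub>2\<^sup>8 f\<^sub>3\<^sup>4 f\<^sub>6 = f\<^sub>1 f\<^sub>2\<^sup>3 f\<^sub>3\<^sup>9 + q f\<^sub>1\<^sup>4 f\<^sub>6\<^sup>9\<close>, which together with \<open>c(q) c(-q) = E\<^sup>2 - O\<^sup>2\<close> yields
  \<open>E = f\<^sub>4\<^sup>3 f\<^sub>6\<^sup>2/(f\<^sub>2\<^sup>2 f\<^sub>1\<^sub>2)\<close> and the 2-dissection \<open>f\<^sub>3/f\<^sub>1\<^sup>3 = E (E + 3 O)/(f\<^sub>2\<^sup>5 f\<^sub>6)\<close>. And since
  \<open>f\<^sub>9/f\<^sub>1 = (f\<^sub>1\<^sub>8/f\<^sub>2)\<^sup>2 \<psi>(q)/\<psi>(q\<^sup>9)\<close>, it reduces the odd part of \<open>f\<^sub>9/f\<^sub>1\<close> to that of \<open>c(q\<^sup>3)\<close>, giving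
  \<open>f\<^sub>2\<^sup>2 f\<^sub>3 f\<^sub>1\<^sub>8/(f\<^sub>1\<^sup>3 f\<^sub>6)\<close> as generating function of \<open>b\<^sub>9(2n+1)\<close>. The odd part of this
  is read off the 2-dissection of \<open>f\<^sub>3/f\<^sub>1\<^sup>3\<close>.\<close>

section \<open>Formal power series modulo powers of the indeterminate\<close>

text \<open>Congruence modulo \<open>fps_X ^ N\<close>: infinite products and theta series are
  compared through truncations that agree with them to a given order.\<close>

definition eq_upto :: "nat \<Rightarrow> 'a fps \<Rightarrow> 'a fps \<Rightarrow> bool" where
  "eq_upto N f g \<longleftrightarrow> (\<forall>i<N. fps_nth f i = fps_nth g i)"

lemma eq_upto_refl [simp, intro]: "eq_upto N f f"
  by (simp add: eq_upto_def)

lemma eq_upto_sym: "eq_upto N f g \<Longrightarrow> eq_upto N g f"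
  by (simp add: eq_upto_def)

lemma eq_upto_trans [trans]: "eq_upto N f g \<Longrightarrow> eq_upto N g h \<Longrightarrow> eq_upto N f h"
  by (simp add: eq_upto_def)

lemma eq_upto_mono: "eq_upto N f g \<Longrightarrow> M \<le> N \<Longrightarrow> eq_upto M f g"
  by (simp add: eq_upto_def)

lemma fps_eq_if_eq_upto: "(\<And>N. eq_upto N f g) \<Longrightarrow> f = g"
  by (auto simp: eq_upto_def fps_eq_iff)

lemma eq_upto_mult:
  fixes f g :: "'a::comm_semiring_0 fps"
  assumes "eq_upto N f f'" "eq_upto N g g'"
  shows "eq_upto N (f * g) (f' * g')"
  using assms by (auto simp: eq_upto_def fps_mult_nth intro!: sum.cong)

lemma eq_upto_power:
  fixes f :: "'a::comm_semiring_1 fps"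
  shows "eq_upto N f g \<Longrightarrow> eq_upto N (f ^ k) (g ^ k)"
  by (induction k) (auto intro: eq_upto_mult)

lemma eq_upto_sum:
  fixes f :: "'b \<Rightarrow> 'a::comm_monoid_add fps"
  shows "(\<And>x. x \<in> A \<Longrightarrow> eq_upto N (f x) (g x)) \<Longrightarrow> eq_upto N (sum f A) (sum g A)"
  by (simp add: eq_upto_def fps_sum_nth)

lemma eq_upto_compose:
  "eq_upto N f g \<Longrightarrow> eq_upto N (f oo h) (g oo h)"
  by (auto simp: eq_upto_def fps_compose_nth intro!: sum.cong)

lemma eq_upto_mult_X_power:
  fixes f :: "'a::comm_semiring_1 fps"
  shows "eq_upto N f g \<Longrightarrow> eq_upto (N + k) (f * fps_X ^ k) (g * fps_X ^ k)"
  by (auto simp: eq_upto_def fps_X_power_mult_right_nth)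

lemma eq_upto_cancel:
  fixes f :: "'a::field fps"
  assumes "fps_nth u 0 \<noteq> 0" "eq_upto N (u * f) (u * g)"
  shows "eq_upto N f g"
  using eq_upto_mult[OF eq_upto_refl assms(2), of "inverse u"] inverse_mult_eq_1[OF assms(1)]
  by (simp flip: mult.assoc)

lemma eq_upto_one_if_mult_cancel:
  fixes u :: "'a::field fps"
  assumes "fps_nth u 0 \<noteq> 0" "eq_upto N (u * f) u"
  shows "eq_upto N f 1"
  using assms eq_upto_cancel[of u N f 1] by simp

section \<open>Euler products over the complex numbers\<close>

definition euler_trunc :: "nat \<Rightarrow> nat \<Rightarrow> complex fps" where
  "euler_trunc k N = (\<Prod>j<N. 1 - fps_X ^ (Suc j * k))"

text \<open>Complex coefficients make a primitive cube root of unity available for the norm of the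
  3-dissection.\<close>

definition fps_of_rat :: "rat fps \<Rightarrow> complex fps" where
  "fps_of_rat f = Abs_fps (\<lambda>n. of_rat (fps_nth f n))"

lemma fps_of_rat_nth [simp]: "fps_nth (fps_of_rat f) n = of_rat (fps_nth f n)"
  by (simp add: fps_of_rat_def)

lemma fps_of_rat_hom:
  "fps_of_rat 1 = 1" "fps_of_rat (numeral m) = numeral m" "fps_of_rat (fps_X ^ k) = fps_X ^ k"
  "fps_of_rat (f + g) = fps_of_rat f + fps_of_rat g"
  "fps_of_rat (f - g) = fps_of_rat f - fps_of_rat g"
  "fps_of_rat (f * g) = fps_of_rat f * fps_of_rat g"
proof -
  show mult: "fps_of_rat (f * g) = fps_of_rat f * fps_of_rat g" for f g
    by (simp add: fps_eq_iff fps_mult_nth of_rat_sum of_rat_mult)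
  show "fps_of_rat 1 = 1" "fps_of_rat (fps_X ^ k) = fps_X ^ k"
    by (simp_all add: fps_eq_iff)
  show "fps_of_rat (numeral m) = numeral m"
    by (simp add: fps_eq_iff fps_numeral_nth)
qed (simp_all add: fps_eq_iff of_rat_add of_rat_diff)

lemma fps_of_rat_power: "fps_of_rat (f ^ k) = fps_of_rat f ^ k"
  by (induction k) (simp_all add: fps_of_rat_hom)

lemma fps_of_rat_prod: "fps_of_rat (\<Prod>x\<in>A. f x) = (\<Prod>x\<in>A. fps_of_rat (f x))"
  by (induction A rule: infinite_finite_induct) (simp_all add: fps_of_rat_hom)

lemma fps_of_rat_inj: "fps_of_rat f = fps_of_rat g \<Longrightarrow> f = g"
  by (simp add: fps_eq_iff)

definition euler :: "nat \<Rightarrow> complex fps" where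
  "euler k = fps_of_rat (euler_f k)"

lemma euler_nth_0: "0 < k \<Longrightarrow> fps_nth (euler k) 0 = 1"
  by (simp add: euler_def euler_f_nth_0)

lemma euler_nonzero: "0 < k \<Longrightarrow> euler k \<noteq> 0"
  using euler_nth_0[of k] by auto

lemma euler_f_nth:
  assumes "0 < k"
  shows "fps_nth (euler_f k) n = fps_nth (\<Prod>j\<le>n. 1 - fps_X ^ (Suc j * k)) n"
  unfolding euler_f_def has_prod_unique[OF euler_f_aux(1)[OF assms], symmetric] by simp

lemma euler_trunc_of_rat: "euler_trunc k N = fps_of_rat (\<Prod>j<N. 1 - fps_X ^ (Suc j * k))"
  by (simp only: euler_trunc_def fps_of_rat_prod fps_of_rat_hom)

text \<open>The omitted factors \<open>1 - q ^ (j * k)\<close> have \<open>j > M\<close>, so their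
  exponents exceed \<open>N\<close>.\<close>

lemma eq_upto_euler:
  assumes "0 < k" "N \<le> M"
  shows "eq_upto N (euler k) (euler_trunc k M)"
  unfolding eq_upto_def
proof (intro allI impI)
  fix i assume "i < N"
  then obtain L where M: "M = Suc L" "i \<le> L"
    using assms(2) by (cases M) auto
  show "fps_nth (euler k) i = fps_nth (euler_trunc k M) i"
    using euler_f_partial_nth[OF assms(1) M(2)] euler_f_nth[OF assms(1), of i]
    by (simp only: euler_trunc_of_rat euler_def fps_of_rat_nth M(1) lessThan_Suc_atMost)
qed

section \<open>Substitutions of the indeterminate\<close>

definition dilate :: "nat \<Rightarrow> complex fps \<Rightarrow> complex fps" where
  "dilate k f = f oo fps_X ^ k"

lemma dilate_nth:
  assumes "0 < k"
  shows "fps_nth (dilate k f) n = (if k dvd n then fps_nth f (n div k) else 0)"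
proof -
  have "fps_nth (dilate k f) n = (\<Sum>i=0..n. if k * i = n then fps_nth f i else 0)"
    unfolding dilate_def fps_compose_nth power_mult[symmetric]
    by (intro sum.cong) (auto simp: fps_X_power_iff)
  also have "\<dots> = (\<Sum>i\<in>{0..n}. if i = n div k \<and> k dvd n then fps_nth f i else 0)"
    using assms by (intro sum.cong) auto
  also have "\<dots> = (if k dvd n then fps_nth f (n div k) else 0)"
    by (cases "k dvd n") (simp_all add: sum.delta)
  finally show ?thesis .
qed

lemma dilate_hom:
  assumes "0 < k"
  shows "dilate k (f + g) = dilate k f + dilate k g"
    "dilate k (f - g) = dilate k f - dilate k g"
    "dilate k (f * g) = dilate k f * dilate k g"
    "dilate k (f ^ m) = dilate k f ^ m"
    "dilate k (numeral w) = numeral w"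
  using assms
  by (simp_all add: dilate_def fps_compose_add_distrib fps_compose_sub_distrib
      fps_compose_mult_distrib fps_compose_power)

lemma dilate_one [simp]: "dilate k 1 = 1"
  by (simp add: dilate_def)

lemma dilate_X: "0 < k \<Longrightarrow> dilate k fps_X = fps_X ^ k"
  by (simp add: dilate_def)

lemma dilate_X_power: "0 < k \<Longrightarrow> dilate k (fps_X ^ n) = fps_X ^ (k * n)"
  by (simp add: dilate_def fps_X_power_compose power_mult)

lemma dilate_dilate: "0 < k \<Longrightarrow> 0 < m \<Longrightarrow> dilate k (dilate m f) = dilate (k * m) f"
  by (rule fps_ext) (auto simp: dilate_nth div_mult2_eq intro: dvd_mult_left)

lemma dilate_inj:
  assumes "0 < k" "dilate k f = dilate k g" shows "f = g"
proof (rule fps_ext)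
  fix n
  have "fps_nth (dilate k f) (k * n) = fps_nth (dilate k g) (k * n)"
    using assms(2) by simp
  thus "fps_nth f n = fps_nth g n"
    using assms(1) by (simp add: dilate_nth)
qed

lemma dilate_euler:
  assumes "0 < k" "0 < m"
  shows "dilate k (euler m) = euler (k * m)"
proof (rule fps_eq_if_eq_upto)
  fix N
  have "eq_upto N (dilate k (euler m)) (dilate k (euler_trunc m N))"
    unfolding dilate_def using assms by (intro eq_upto_compose eq_upto_euler) auto
  also have "dilate k (euler_trunc m N) = (\<Prod>j<N. dilate k (1 - fps_X ^ (Suc j * m)))"
    unfolding dilate_def euler_trunc_def using assms
    by (intro fps_compose_prod_distrib) simp
  also have "\<dots> = (\<Prod>j<N. 1 - fps_X ^ (Suc j * (k * m)))"
  proof (intro prod.cong refl)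
    fix j
    have "dilate k (1 - fps_X ^ (Suc j * m)) = 1 - dilate k (fps_X ^ (Suc j * m))"
      by (simp only: dilate_hom(2)[OF assms(1)] dilate_one)
    also have "dilate k (fps_X ^ (Suc j * m)) = fps_X ^ (k * (Suc j * m))"
      by (rule dilate_X_power[OF assms(1)])
    also have "k * (Suc j * m) = Suc j * (k * m)"
      by (rule mult.left_commute)
    finally show "dilate k (1 - fps_X ^ (Suc j * m)) = 1 - fps_X ^ (Suc j * (k * m))" .
  qed
  also have "\<dots> = euler_trunc (k * m) N"
    unfolding euler_trunc_def ..
  also have "eq_upto N (euler_trunc (k * m) N) (euler (k * m))"
    using assms by (intro eq_upto_euler[THEN eq_upto_sym]) auto
  finally show "eq_upto N (dilate k (euler m)) (euler (k * m))" .
qed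

text \<open>Used with \<open>w\<close> a root of unity of order 2 or 3: multiplying the rescalings
  of a series over all square or cube roots of unity gives its norm, a series in
  \<open>q\<^sup>2\<close> or \<open>q\<^sup>3\<close>.\<close>

definition rescale :: "complex \<Rightarrow> complex fps \<Rightarrow> complex fps" where
  "rescale w f = f oo (fps_const w * fps_X)"

lemma rescale_nth: "fps_nth (rescale w f) n = w ^ n * fps_nth f n"
  unfolding rescale_def by simp

lemma rescale_hom:
  "rescale w (f + g) = rescale w f + rescale w g"
  "rescale w (f - g) = rescale w f - rescale w g"
  "rescale w (f * g) = rescale w f * rescale w g"
  "rescale w (f ^ m) = rescale w f ^ m"
  "rescale w fps_X = fps_const w * fps_X"
  by (simp_all add: rescale_def fps_compose_add_distrib fps_compose_sub_distrib
      fps_compose_mult_distrib fps_compose_power)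

lemma rescale_dilate:
  assumes "0 < k" "w ^ k = 1"
  shows "rescale w (dilate k f) = dilate k f"
  using assms by (auto simp: fps_eq_iff rescale_nth dilate_nth power_mult elim!: dvdE)

lemma rescale_euler_trunc:
  "rescale w (euler_trunc k N) = (\<Prod>j<N. 1 - fps_const (w ^ (Suc j * k)) * fps_X ^ (Suc j * k))"
  by (simp add: rescale_def euler_trunc_def fps_compose_prod_distrib fps_compose_sub_distrib
        fps_X_power_compose power_mult_distrib fps_const_power)

lemma eq_upto_rescale: "eq_upto N f g \<Longrightarrow> eq_upto N (rescale w f) (rescale w g)"
  by (simp add: rescale_def eq_upto_compose)

section \<open>The finite Jacobi triple product\<close>

text \<open>The Gaussian binomial coefficient, given by its Pascal recurrence, which needs no
  division and makes sense in every commutative ring.\<close>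

fun qbinomial :: "'a::comm_ring_1 \<Rightarrow> nat \<Rightarrow> nat \<Rightarrow> 'a" where
  "qbinomial q n 0 = 1"
| "qbinomial q 0 (Suc k) = 0"
| "qbinomial q (Suc n) (Suc k) = qbinomial q n k + q ^ Suc k * qbinomial q n (Suc k)"

lemma qbinomial_eq_0: "n < k \<Longrightarrow> qbinomial q n k = 0"
  by (induction q n k rule: qbinomial.induct) auto

text \<open>The ratio of neighbouring Gaussian binomials with denominators cleared. The inductive
  step uses the claim for both \<open>k\<close> and \<open>Suc k\<close> in row
  \<open>n\<close>.\<close>

lemma qbinomial_absorb:
  "k \<le> n \<Longrightarrow> (1 - q ^ (n - k)) * qbinomial q n k = (1 - q ^ Suc k) * qbinomial q n (Suc k)"
proof (induction q n k rule: qbinomial.induct)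
  case (1 q n)
  show ?case
  proof (induction n)
    case (Suc n)
    have "(1 - q ^ Suc 0) * qbinomial q (Suc n) (Suc 0)
        = (1 - q) + q * ((1 - q ^ Suc 0) * qbinomial q n (Suc 0))"
      by (simp add: algebra_simps)
    also have "(1 - q ^ Suc 0) * qbinomial q n (Suc 0) = 1 - q ^ n"
      using Suc by simp
    finally show ?case by (simp add: algebra_simps)
  qed simp
next
  case (3 q n k)
  show ?case
  proof (cases "k < n")
    case True
    have 1: "(1 - q ^ (n - k)) * qbinomial q n k = (1 - q ^ Suc k) * qbinomial q n (Suc k)"
      using 3 True by simp
    have 2: "(1 - q ^ (n - Suc k)) * qbinomial q n (Suc k)
        = (1 - q ^ Suc (Suc k)) * qbinomial q n (Suc (Suc k))"
      using 3 True by simp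
    have 3: "q ^ (n - k) = q * q ^ (n - Suc k)"
      using True by (simp add: Suc_diff_Suc flip: power_Suc)
    have "(1 - q ^ Suc (Suc k)) * qbinomial q (Suc n) (Suc (Suc k))
        = (1 - q ^ Suc (Suc k)) * qbinomial q n (Suc k) + q ^ Suc (Suc k) *
          ((1 - q ^ (n - Suc k)) * qbinomial q n (Suc k))"
      unfolding 2 by (simp add: algebra_simps)
    also have "\<dots> = (1 - q ^ Suc k) * qbinomial q n (Suc k)
        + (1 - q ^ (n - k)) * q ^ Suc k * qbinomial q n (Suc k)"
      unfolding 3 by (simp add: algebra_simps)
    also have "\<dots> = (1 - q ^ (n - k)) * qbinomial q (Suc n) (Suc k)"
      unfolding 1[symmetric] by (simp add: algebra_simps)
    finally show ?thesis by simp
  next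
    case False
    thus ?thesis using 3 by (simp add: qbinomial_eq_0)
  qed
qed simp

text \<open>The mirrored Pascal rule; it differs from the defining one exactly by the absorption
  identity.\<close>

lemma qbinomial_Suc_Suc_alt:
  assumes "k \<le> n"
  shows "qbinomial q (Suc n) (Suc k) = q ^ (n - k) * qbinomial q n k + qbinomial q n (Suc k)"
  using qbinomial_absorb[OF assms, of q] by (simp add: algebra_simps)

text \<open>The quotient of \<open>q\<close>-factorials with denominators cleared; each step in
  \<open>k\<close> moves one factor across by absorption.\<close>

lemma qbinomial_fact:
  assumes "k \<le> n"
  shows "qbinomial q n k * (\<Prod>j<k. 1 - q ^ Suc j) * (\<Prod>j<n - k. 1 - q ^ Suc j)
    = (\<Prod>j<n. 1 - q ^ Suc j)"
  using assms
proof (induction k)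
  case (Suc k)
  have "n - k = Suc (n - Suc k)"
    using Suc.prems by simp
  hence 1: "(\<Prod>j<n - k. 1 - q ^ Suc j) = (\<Prod>j<n - Suc k. 1 - q ^ Suc j) * (1 - q ^ (n - k))"
    by simp
  have "qbinomial q n (Suc k) * (\<Prod>j<Suc k. 1 - q ^ Suc j) * (\<Prod>j<n - Suc k. 1 - q ^ Suc j)
      = ((1 - q ^ Suc k) * qbinomial q n (Suc k)) * (\<Prod>j<k. 1 - q ^ Suc j)
        * (\<Prod>j<n - Suc k. 1 - q ^ Suc j)"
    by (simp only: prod.lessThan_Suc mult_ac)
  also have "\<dots> = qbinomial q n k * (\<Prod>j<k. 1 - q ^ Suc j) * (\<Prod>j<n - k. 1 - q ^ Suc j)"
    unfolding qbinomial_absorb[OF Suc_leD[OF Suc.prems], symmetric] 1 by (simp only: mult_ac)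
  also have "\<dots> = (\<Prod>j<n. 1 - q ^ Suc j)"
    using Suc by simp
  finally show ?case .
qed simp

definition tri :: "int \<Rightarrow> nat" where
  "tri k = nat (k * (k - 1) div 2)"

lemma int_tri: "2 * int (tri k) = k * (k - 1)"
proof -
  have "0 \<le> k * (k - 1)"
    by (cases "k \<ge> 1") (auto simp: zero_le_mult_iff)
  moreover have "even (k * (k - 1))" by simp
  ultimately show ?thesis by (simp add: tri_def)
qed

lemma tri_Suc: "int (tri (k + 1)) = int (tri k) + k"
  using int_tri[of k] int_tri[of "k + 1"] by (simp add: algebra_simps)

lemma tri_minus: "int (tri (- k)) = int (tri k) + k"
  using int_tri[of k] int_tri[of "- k"] by (simp add: algebra_simps)

text \<open>A finite triple product as a polynomial in \<open>z\<close>: the factors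
  \<open>z + q ^ i\<close> replace \<open>1 + q ^ i / z\<close>, so the coefficient of
  \<open>z ^ j\<close> belongs to the Laurent exponent \<open>j - M\<close>.\<close>

definition jacobi_poly :: "'a::comm_ring_1 \<Rightarrow> nat \<Rightarrow> nat \<Rightarrow> 'a poly" where
  "jacobi_poly q M N = (\<Prod>i<M. [:q ^ Suc i, 1:]) * (\<Prod>i<N. [:1, q ^ i:])"

lemma coeff_linear_mult:
  "coeff ([:a, b:] * p) j = a * coeff p j + (case j of 0 \<Rightarrow> 0 | Suc k \<Rightarrow> b * coeff p k)"
  by (simp add: mult_pCons_left coeff_pCons split: nat.split)

text \<open>For \<open>M = 0\<close> this is the \<open>q\<close>-binomial theorem, by induction on
  \<open>N\<close> with the mirrored Pascal rule; the induction on \<open>M\<close> then uses the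
  defining rule.\<close>

lemma coeff_jacobi_poly:
  "coeff (jacobi_poly q M N) j = qbinomial q (M + N) j * q ^ tri (int j - int M)"
proof (induction M arbitrary: j)
  case 0
  show ?case
  proof (induction N arbitrary: j)
    case 0
    show ?case by (cases j) (simp_all add: jacobi_poly_def tri_def)
  next
    case (Suc N)
    have rec: "jacobi_poly q 0 (Suc N) = [:1, q ^ N:] * jacobi_poly q 0 N"
      unfolding jacobi_poly_def prod.lessThan_Suc by (simp only: mult_ac)
    show ?case
    proof (cases j)
      case 0
      thus ?thesis unfolding rec coeff_linear_mult Suc.IH by simp
    next
      case j: (Suc k)
      show ?thesis
      proof (cases "k \<le> N")
        case True
        have "int N + int (tri (int k)) = int (N - k) + int (tri (int k + 1))"
          using True tri_Suc[of "int k"] by simp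
        hence e: "N + tri (int k) = N - k + tri (1 + int k)"
          by (metis of_nat_add of_nat_eq_iff add.commute)
        have e': "q ^ N * q ^ tri (int k) = q ^ (N - k) * q ^ tri (1 + int k)"
          unfolding power_add[symmetric] e ..
        have "coeff (jacobi_poly q 0 (Suc N)) j
            = (qbinomial q N (Suc k) + q ^ (N - k) * qbinomial q N k) * q ^ tri (1 + int k)"
          unfolding rec coeff_linear_mult Suc.IH j
          by (simp add: distrib_left distrib_right mult.left_commute[of "q ^ N"] e' mult_ac)
        also have "\<dots> = qbinomial q (Suc N) (Suc k) * q ^ tri (1 + int k)"
          using qbinomial_Suc_Suc_alt[OF True, of q] by (simp only: add.commute)
        finally show ?thesis by (simp add: j)
      next
        case False
        thus ?thesis unfolding rec coeff_linear_mult Suc.IH j by (simp add: qbinomial_eq_0)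
      qed
    qed
  qed
next
  case (Suc M)
  have rec: "jacobi_poly q (Suc M) N = [:q ^ Suc M, 1:] * jacobi_poly q M N"
    unfolding jacobi_poly_def prod.lessThan_Suc by (simp only: mult_ac)
  have e: "q ^ Suc M * q ^ tri (int j - int M) = q ^ j * q ^ tri (int j - int (Suc M))" for j
  proof -
    have "int (Suc M) + int (tri (int j - int M)) = int j + int (tri (int j - int (Suc M)))"
      using tri_Suc[of "int j - int (Suc M)"] by (simp add: algebra_simps)
    hence "Suc M + tri (int j - int M) = j + tri (int j - int (Suc M))"
      by (metis of_nat_add of_nat_eq_iff)
    thus ?thesis by (simp only: flip: power_add)
  qed
  show ?case
  proof (cases j)
    case 0
    thus ?thesis unfolding rec coeff_linear_mult Suc.IH using e[of 0] by simp
  next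
    case j: (Suc k)
    have "coeff (jacobi_poly q (Suc M) N) j = qbinomial q (M + N) (Suc k) *
        (q ^ Suc M * q ^ tri (int (Suc k) - int M)) + qbinomial q (M + N) k * q ^ tri (int k - int M)"
      unfolding rec coeff_linear_mult Suc.IH j by (simp add: algebra_simps)
    also have "\<dots> = qbinomial q (Suc (M + N)) (Suc k) * q ^ tri (int k - int M)"
      unfolding e by (simp add: algebra_simps)
    finally show ?thesis by (simp add: j)
  qed
qed

lemma degree_jacobi_poly: "degree (jacobi_poly q M N) \<le> M + N"
  by (rule degree_le) (simp add: coeff_jacobi_poly qbinomial_eq_0)

lemma finite_jacobi_triple_product:
  fixes q z :: "'a::comm_ring_1"
  shows "(\<Prod>i<N. (z + q ^ Suc i) * (1 + z * q ^ i))
    = (\<Sum>j\<le>2 * N. qbinomial q (2 * N) j * q ^ tri (int j - int N) * z ^ j)"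
proof -
  have "(\<Prod>i<N. (z + q ^ Suc i) * (1 + z * q ^ i)) = poly (jacobi_poly q N N) z"
    by (simp add: jacobi_poly_def poly_prod prod.distrib add.commute)
  also have "\<dots> = (\<Sum>j\<le>2 * N. coeff (jacobi_poly q N N) j * z ^ j)"
    using degree_jacobi_poly[of q N N]
    by (subst poly_as_sum_of_monoms'[of _ "2 * N", symmetric])
      (simp_all add: poly_sum poly_monom mult_2)
  finally show ?thesis
    by (simp add: coeff_jacobi_poly mult_2)
qed

lemma euler_trunc_alt: "euler_trunc k N = (\<Prod>j<N. 1 - (fps_X ^ k) ^ Suc j)"
  unfolding euler_trunc_def power_mult[symmetric] by (simp only: mult.commute)

text \<open>The Gaussian binomial tends to \<open>1 / euler s\<close> when both \<open>k\<close> and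
  \<open>n - k\<close> grow. A second factor \<open>euler s\<close> is introduced so that the two
  can be truncated at \<open>n - k\<close> and \<open>k\<close> to match the factorial formula, and
  is cancelled afterwards.\<close>

lemma eq_upto_qbinomial:
  assumes "0 < s" "m \<le> k" "m + k \<le> n"
  shows "eq_upto m (euler s * qbinomial (fps_X ^ s) n k) 1"
proof (rule eq_upto_one_if_mult_cancel)
  show "fps_nth (euler s) 0 \<noteq> 0"
    using assms(1) by (simp add: euler_nth_0)
  let ?G = "qbinomial (fps_X ^ s) n k"
  have "eq_upto m (euler s * (euler s * ?G)) (euler_trunc s (n - k) * (euler_trunc s k * ?G))"
    using assms by (intro eq_upto_mult eq_upto_euler eq_upto_refl) auto
  also have "euler_trunc s (n - k) * (euler_trunc s k * ?G) = euler_trunc s n"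
    using qbinomial_fact[OF add_leD2[OF assms(3)], of "fps_X ^ s"]
    by (simp only: euler_trunc_alt mult_ac)
  also have "eq_upto m (euler_trunc s n) (euler s)"
    using assms by (intro eq_upto_euler[THEN eq_upto_sym]) auto
  finally show "eq_upto m (euler s * (euler s * ?G)) (euler s)" .
qed

section \<open>Theta series\<close>

text \<open>The exponent of the general term of a theta series; for \<open>r \<le> s\<close> the
  integer inside \<open>nat\<close> is nonnegative, so nothing is cut off.\<close>

definition theta_exp :: "nat \<Rightarrow> nat \<Rightarrow> int \<Rightarrow> nat" where
  "theta_exp s r k = nat (int s * int (tri k) + int r * k)"

text \<open>A negative \<open>k\<close> is turned into \<open>m = - k\<close>, which replaces
  \<open>r\<close> by \<open>s - r\<close>. The second bound leaves finitely many \<open>k\<close>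
  for each coefficient.\<close>

lemma int_theta_exp_bound:
  assumes "0 < s" "r \<le> s"
  shows "int (theta_exp s r k) = int s * int (tri k) + int r * k" "\<bar>k\<bar> \<le> int (theta_exp s r k) + 1"
proof -
  have tri_ge: "int (tri m) \<ge> m - 1" for m
  proof -
    have "0 \<le> (m - 1) * (m - 2)"
      by (cases "m \<ge> 2") (auto simp: zero_le_mult_iff)
    also have "\<dots> = 2 * (int (tri m) - (m - 1))"
      using int_tri[of m] by (simp add: algebra_simps)
    finally show ?thesis by simp
  qed
  have "\<bar>k\<bar> - 1 \<le> int s * int (tri k) + int r * k \<and> 0 \<le> int s * int (tri k) + int r * k"
  proof (cases "k \<ge> 0")
    case True
    have "int (tri k) \<le> int s * int (tri k)"
      using assms(1) by (simp add: mult_le_cancel_right1)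
    moreover have "int r * k \<ge> 0"
      using True by simp
    ultimately show ?thesis using tri_ge[of k] True by linarith
  next
    case False
    define m where "m = - k"
    have eq: "int (tri k) = int (tri m) + m"
      using tri_minus[of m] by (simp add: m_def)
    have "int s * int (tri k) + int r * k = int s * int (tri m) + (int s - int r) * m"
      unfolding eq by (simp add: m_def algebra_simps)
    moreover have "(int s - int r) * m \<ge> 0"
      using assms(2) False by (intro mult_nonneg_nonneg) (simp_all add: m_def)
    moreover have "int (tri m) \<le> int s * int (tri m)"
      using assms(1) by (simp add: mult_le_cancel_right1)
    ultimately show ?thesis using False tri_ge[of m] by (simp add: m_def)
  qed
  thus "int (theta_exp s r k) = int s * int (tri k) + int r * k" "\<bar>k\<bar> \<le> int (theta_exp s r k) + 1"
    by (simp_all add: theta_exp_def)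
qed

text \<open>Near the ends of the range the Gaussian binomial is far from its limit, but the exponent
  \<open>e\<close> compensates: agreement holds to order \<open>m + e\<close> with
  \<open>m = N - \<bar>j - N\<bar>\<close>, and
  \<open>e \<ge> \<bar>j - N\<bar> - 1\<close>.\<close>

lemma eq_upto_qbinomial_theta_exp:
  assumes "0 < s" "r \<le> s" "j \<le> 2 * N"
  defines "e \<equiv> theta_exp s r (int j - int N)"
  shows "eq_upto (N - 1) (euler s * (qbinomial (fps_X ^ s) (2 * N) j * fps_X ^ e)) (fps_X ^ e)"
proof -
  define m where "m = min j (2 * N - j)"
  have "eq_upto (m + e) (euler s * qbinomial (fps_X ^ s) (2 * N) j * fps_X ^ e) (1 * fps_X ^ e)"
    using assms by (intro eq_upto_mult_X_power eq_upto_qbinomial) (auto simp: m_def)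
  moreover have "N - 1 \<le> m + e"
    using int_theta_exp_bound(2)[OF assms(1,2), of "int j - int N"] assms(3)
    unfolding m_def e_def by linarith
  ultimately show ?thesis
    by (auto simp: mult.assoc intro: eq_upto_mono)
qed

text \<open>An infinite fibre of \<open>e\<close> would be counted as 0; all fibres below are finite.\<close>

definition counting_fps :: "('a \<Rightarrow> nat) \<Rightarrow> complex fps" where
  "counting_fps e = Abs_fps (\<lambda>n. of_nat (card {x. e x = n}))"

lemma counting_fps_nth [simp]: "fps_nth (counting_fps e) n = of_nat (card {x. e x = n})"
  by (simp add: counting_fps_def)

text \<open>Passes from a finite sum to a full theta series: the indices missed by
  \<open>\<phi>\<close> have exponents of at least \<open>M\<close>.\<close>

lemma eq_upto_counting_fps:
  assumes "finite S" "inj_on \<phi> S" "\<And>x. x \<in> S \<Longrightarrow> e' x = e (\<phi> x)" "\<And>y. e y < M \<Longrightarrow> y \<in> \<phi> ` S"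
  shows "eq_upto M (\<Sum>x\<in>S. fps_X ^ e' x) (counting_fps e)"
  unfolding eq_upto_def
proof (intro allI impI)
  fix i assume i: "i < M"
  have "fps_nth (\<Sum>x\<in>S. fps_X ^ e' x :: complex fps) i = (\<Sum>x\<in>S. if e' x = i then 1 else 0)"
    by (auto simp: fps_sum_nth intro!: sum.cong)
  also have "\<dots> = of_nat (card {x\<in>S. e' x = i})"
    using assms(1) by (simp add: sum.If_cases Collect_conj_eq Int_commute)
  also have "{y. e y = i} = \<phi> ` {x\<in>S. e' x = i}"
    using assms(3,4) i by fastforce
  hence "card {x\<in>S. e' x = i} = card {y. e y = i}"
    using assms(2) by (auto intro!: card_image[symmetric] inj_on_subset[OF assms(2)])
  finally show "fps_nth (\<Sum>x\<in>S. fps_X ^ e' x :: complex fps) i = fps_nth (counting_fps e) i"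
    by simp
qed

definition theta :: "nat \<Rightarrow> nat \<Rightarrow> complex fps" where
  "theta s r = counting_fps (theta_exp s r)"

text \<open>The finite identity at \<open>q ^ s\<close> and \<open>z = q ^ r\<close>. Multiplying by
  \<open>q ^ (r * N)\<close> turns \<open>1 + q ^ (s * Suc i - r)\<close> into the required factor
  \<open>z + (q ^ s) ^ Suc i\<close>; this power is cancelled again before the passage to the
  limit.\<close>

lemma jacobi_triple_product:
  assumes "0 < s" "r \<le> s"
  shows "eq_upto (N - 1)
    (euler s * (\<Prod>i<N. (1 + fps_X ^ (s * i + r)) * (1 + fps_X ^ (s * Suc i - r)))) (theta s r)"
proof -
  let ?X = "fps_X :: complex fps"
  let ?e = "\<lambda>j. theta_exp s r (int j - int N)"
  let ?P = "\<Prod>i<N. (1 + ?X ^ (s * i + r)) * (1 + ?X ^ (s * Suc i - r))"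
  let ?S = "\<Sum>j\<le>2 * N. qbinomial (?X ^ s) (2 * N) j * ?X ^ ?e j"
  have "?X ^ (r * N) * ?P
      = (\<Prod>i<N. ?X ^ r * ((1 + ?X ^ (s * i + r)) * (1 + ?X ^ (s * Suc i - r))))"
    by (simp add: prod.distrib power_mult)
  also have "\<dots> = (\<Prod>i<N. (?X ^ r + (?X ^ s) ^ Suc i) * (1 + ?X ^ r * (?X ^ s) ^ i))"
  proof (intro prod.cong refl)
    fix i
    have "r \<le> s * Suc i" using assms(2) by simp
    hence 1: "?X ^ r * ?X ^ (s * Suc i - r) = (?X ^ s) ^ Suc i"
      by (simp only: le_add_diff_inverse flip: power_add power_mult)
    have 2: "?X ^ (s * i + r) = ?X ^ r * (?X ^ s) ^ i"
      by (subst add.commute) (simp only: power_add power_mult)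
    show "?X ^ r * ((1 + ?X ^ (s * i + r)) * (1 + ?X ^ (s * Suc i - r)))
        = (?X ^ r + (?X ^ s) ^ Suc i) * (1 + ?X ^ r * (?X ^ s) ^ i)"
      unfolding 1[symmetric] 2[symmetric]
      by (simp only: distrib_left distrib_right mult_1_left mult_1_right add_ac mult_ac)
  qed
  also have "\<dots> = (\<Sum>j\<le>2 * N. qbinomial (?X ^ s) (2 * N) j * (?X ^ s) ^ tri (int j - int N)
      * (?X ^ r) ^ j)"
    by (rule finite_jacobi_triple_product)
  also have "\<dots> = ?X ^ (r * N) * ?S"
    unfolding sum_distrib_left
  proof (intro sum.cong refl)
    fix j
    have "int (s * tri (int j - int N) + r * j) = int (r * N + ?e j)"
      using int_theta_exp_bound(1)[OF assms, of "int j - int N"] by (simp add: algebra_simps)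
    hence "s * tri (int j - int N) + r * j = r * N + ?e j"
      by (simp only: of_nat_eq_iff)
    hence "(?X ^ s) ^ tri (int j - int N) * (?X ^ r) ^ j = ?X ^ (r * N) * ?X ^ ?e j"
      by (simp only: flip: power_add power_mult)
    thus "qbinomial (?X ^ s) (2 * N) j * (?X ^ s) ^ tri (int j - int N) * (?X ^ r) ^ j
        = ?X ^ (r * N) * (qbinomial (?X ^ s) (2 * N) j * ?X ^ ?e j)"
      by (simp only: mult.assoc mult.left_commute[of "?X ^ (r * N)"])
  qed
  finally have "?P = ?S" by simp
  hence "euler s * ?P = (\<Sum>j\<le>2 * N. euler s * (qbinomial (?X ^ s) (2 * N) j * ?X ^ ?e j))"
    by (simp only: sum_distrib_left)
  also have "eq_upto (N - 1) \<dots> (\<Sum>j\<le>2 * N. ?X ^ ?e j)"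
    using assms by (intro eq_upto_sum eq_upto_qbinomial_theta_exp) auto
  also have "eq_upto (N - 1) (\<Sum>j\<le>2 * N. ?X ^ ?e j) (theta s r)"
    unfolding theta_def
  proof (rule eq_upto_counting_fps[where \<phi> = "\<lambda>j. int j - int N"])
    fix k assume "theta_exp s r k < N - 1"
    hence "\<bar>k\<bar> \<le> int N"
      using int_theta_exp_bound(2)[OF assms, of k] by linarith
    thus "k \<in> (\<lambda>j. int j - int N) ` {..2 * N}"
      by (intro image_eqI[of _ _ "nat (k + int N)"]) auto
  qed (auto simp: inj_on_def)
  finally show ?thesis .
qed

section \<open>The cubic theta series\<close>

text \<open>Three theta exponents whose indices sum to zero, as they arise in the constant term of a
  product of three triple products. The resulting quadratic form is the norm form of
  3-cores.\<close>

definition cubic_exp :: "int \<times> int \<Rightarrow> nat" where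
  "cubic_exp = (\<lambda>(b, c). theta_exp 3 1 b + theta_exp 3 2 c + theta_exp 3 0 (- b - c))"

definition cubic_theta :: "complex fps" where
  "cubic_theta = counting_fps cubic_exp"

lemma int_cubic_exp: "int (cubic_exp (b, c)) = 3 * b\<^sup>2 + 3 * b * c + 3 * c\<^sup>2 + b + 2 * c"
  using int_tri[of b] int_tri[of c] int_tri[of "- b - c"]
  by (simp add: cubic_exp_def int_theta_exp_bound(1) power2_eq_square algebra_simps)

lemma prod_lessThan_triple:
  "(\<Prod>i<3 * N. f i) = (\<Prod>i<N. f (3 * i) * f (3 * i + 1) * f (3 * i + 2))"
  for f :: "nat \<Rightarrow> 'a::comm_monoid_mult"
proof (induction N)
  case (Suc N)
  have "3 * Suc N = Suc (Suc (Suc (3 * N)))" by simp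
  thus ?case using Suc by (simp only: prod.lessThan_Suc mult.assoc) simp
qed simp

text \<open>Splits the factors according to the residue modulo 3 of the exponent of \<open>q\<close>. The factor
  \<open>q ^ (3 * N)\<close> clears the negative powers coming from \<open>z \<mapsto> q z\<close> and \<open>z \<mapsto> q\<^sup>2 z\<close>.\<close>

lemma jacobi_poly_cube:
  fixes q :: "'a::comm_ring_1" and N :: nat
  defines "J \<equiv> jacobi_poly (q ^ 3) N N"
  shows "smult (q ^ (3 * N)) (jacobi_poly q (3 * N) (3 * N))
    = pcompose J [:0, q:] * (pcompose J [:0, q ^ 2:] * J)"
proof -
  have lin: "pcompose J [:0, c:] =
    (\<Prod>i<N. [:(q ^ 3) ^ Suc i, c:]) * (\<Prod>i<N. [:1, c * (q ^ 3) ^ i:])" for c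
    unfolding J_def jacobi_poly_def by (simp add: pcompose_mult pcompose_prod pcompose_pCons mult.commute)
  have J: "J = pcompose J [:0, 1:]" by (simp add: pcompose_idR)
  have A: "smult (q ^ (3 * N)) (\<Prod>i<3 * N. [:q ^ Suc i, 1:])
    = (\<Prod>i<N. [:(q ^ 3) ^ Suc i, q:] * [:(q ^ 3) ^ Suc i, q ^ 2:] * [:(q ^ 3) ^ Suc i, 1:])"
  proof -
    have "smult (q ^ (3 * N)) (\<Prod>i<3 * N. [:q ^ Suc i, 1:])
      = (\<Prod>i<N. smult (q ^ 3) ([:q ^ Suc (3 * i), 1:] * [:q ^ Suc (3 * i + 1), 1:]
          * [:q ^ Suc (3 * i + 2), 1:]))"
      unfolding prod_lessThan_triple prod_smult by (simp add: power_mult)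
    also have "\<dots> = (\<Prod>i<N. [:(q ^ 3) ^ Suc i, q:] * [:(q ^ 3) ^ Suc i, q ^ 2:] * [:(q ^ 3) ^ Suc i, 1:])"
    proof (intro prod.cong refl)
      fix i
      \<comment> \<open>The factors with exponents \<open>3i+1\<close>, \<open>3i+2\<close>,
        \<open>3i+3\<close> receive \<open>q ^ 2\<close>, \<open>q\<close>, \<open>1\<close>, so all
        three get the same constant term; together this uses up the \<open>q ^ 3\<close> available
        for each \<open>i\<close>.\<close>
      have e: "(q ^ 3) ^ Suc i = q ^ m * q ^ Suc (3 * i + (2 - m))" if "m \<le> 2" for m
        unfolding power_mult[symmetric] power_add[symmetric]
        using that by (intro arg_cong[of _ _ "power q"]) simp
      have 1: "[:(q ^ 3) ^ Suc i, q ^ 2:] = smult (q ^ 2) [:q ^ Suc (3 * i), 1:]"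
        using e[of 2] by (simp del: power_Suc)
      have 2: "[:(q ^ 3) ^ Suc i, q:] = smult q [:q ^ Suc (3 * i + 1), 1:]"
        using e[of 1] by (simp del: power_Suc)
      have 3: "[:(q ^ 3) ^ Suc i, 1:] = [:q ^ Suc (3 * i + 2), 1:]"
        using e[of 0] by (simp del: power_Suc)
      have "q ^ 3 = q * q ^ 2" by (simp add: eval_nat_numeral)
      thus "smult (q ^ 3) ([:q ^ Suc (3 * i), 1:] * [:q ^ Suc (3 * i + 1), 1:]
          * [:q ^ Suc (3 * i + 2), 1:])
        = [:(q ^ 3) ^ Suc i, q:] * [:(q ^ 3) ^ Suc i, q ^ 2:] * [:(q ^ 3) ^ Suc i, 1:]"
        unfolding 1 2 3 by (simp only: mult_smult_left mult_smult_right smult_smult mult_ac)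
    qed
    finally show ?thesis .
  qed
  have B: "(\<Prod>i<3 * N. [:1, q ^ i:])
    = (\<Prod>i<N. [:1, q * (q ^ 3) ^ i:] * [:1, q ^ 2 * (q ^ 3) ^ i:] * [:1, 1 * (q ^ 3) ^ i:])"
    unfolding prod_lessThan_triple power_mult[symmetric]
    by (simp only: power_add power_one_right mult_ac mult_1)
  have "smult (q ^ (3 * N)) (jacobi_poly q (3 * N) (3 * N))
    = smult (q ^ (3 * N)) (\<Prod>i<3 * N. [:q ^ Suc i, 1:]) * (\<Prod>i<3 * N. [:1, q ^ i:])"
    by (simp only: jacobi_poly_def mult_smult_left)
  also have "\<dots> = pcompose J [:0, q:] * (pcompose J [:0, q ^ 2:] * pcompose J [:0, 1:])"
    unfolding A B lin prod.distrib by (simp only: mult_ac)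
  finally show ?thesis
    using J by simp
qed

text \<open>Comparison of the coefficients of \<open>z ^ (3 * N)\<close> in the preceding identity, i.e. of the
  constant terms of the underlying Laurent polynomials in \<open>z\<close>.\<close>

lemma euler_cubic_theta: "cubic_theta * euler 1 = euler 3 ^ 3"
proof (rule fps_eq_if_eq_upto)
  fix M
  define N where "N = Suc M"
  let ?X = "fps_X :: complex fps"
  let ?J = "jacobi_poly (?X ^ 3) N N"
  let ?S = "SIGMA j:{..3 * N}. {..3 * N - j}"
  \<comment> \<open>The pairs for which all three indices \<open>j\<close>, \<open>l\<close> and
    \<open>3 * N - j - l\<close> lie between 0 and \<open>2 * N\<close>.\<close>
  let ?T = "{(j, l). j \<le> 2 * N \<and> l \<le> 2 * N \<and> N \<le> j + l \<and> j + l \<le> 3 * N}"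
  let ?G = "\<lambda>j. qbinomial (?X ^ 3) (2 * N) j"
  let ?e = "\<lambda>r j. theta_exp 3 r (int j - int N)"
  let ?t = "\<lambda>(j, l). (?G j * ?X ^ ?e 1 j) * ((?G l * ?X ^ ?e 2 l)
    * (?G (3 * N - j - l) * ?X ^ ?e 0 (3 * N - j - l)))"
  have fin: "finite ?T"
    by (rule finite_subset[of _ "{..2 * N} \<times> {..2 * N}"]) auto
  \<comment> \<open>In the left-hand product the coefficient of \<open>z ^ (3 * N)\<close> is the
    central one, where \<open>tri\<close> vanishes.\<close>
  have "?X ^ (3 * N) * qbinomial ?X (3 * N + 3 * N) (3 * N)
      = coeff (smult (?X ^ (3 * N)) (jacobi_poly ?X (3 * N) (3 * N))) (3 * N)"
    by (simp add: coeff_jacobi_poly tri_def)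
  also have "\<dots> = (\<Sum>j\<le>3 * N. (\<Sum>l\<le>3 * N - j. ?X ^ j * coeff ?J j *
      ((?X ^ 2) ^ l * coeff ?J l * coeff ?J (3 * N - j - l))))"
    unfolding jacobi_poly_cube by (simp only: coeff_mult coeff_pcompose_linear sum_distrib_left)
  also have "\<dots> = (\<Sum>(j, l)\<in>?S. ?X ^ j * coeff ?J j *
      ((?X ^ 2) ^ l * coeff ?J l * coeff ?J (3 * N - j - l)))"
    by (rule sum.Sigma) auto
  also have "\<dots> = (\<Sum>p\<in>?S. ?X ^ (3 * N) * ?t p)"
  proof (intro sum.cong refl)
    fix p assume "p \<in> ?S"
    then obtain j l where p: "p = (j, l)" and "j \<le> 3 * N" "l \<le> 3 * N - j"
      by auto
    define i where "i = 3 * N - j - l"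
    have i: "i + j + l = 3 * N"
      using \<open>j \<le> 3 * N\<close> \<open>l \<le> 3 * N - j\<close> by (simp add: i_def)
    \<comment> \<open>Centring the linear terms \<open>j\<close> and \<open>2 * l\<close> at
      \<open>N\<close> costs \<open>N + 2 * N\<close>, which accounts for the factor
      \<open>q ^ (3 * N)\<close>.\<close>
    have "int (j + 3 * tri (int j - int N) + (2 * l + 3 * tri (int l - int N) + 3 * tri (int i - int N)))
        = int (3 * N + (?e 1 j + (?e 2 l + ?e 0 i)))"
      using i by (simp add: int_theta_exp_bound(1))
    hence "j + 3 * tri (int j - int N) + (2 * l + 3 * tri (int l - int N) + 3 * tri (int i - int N))
        = 3 * N + (?e 1 j + (?e 2 l + ?e 0 i))"
      by (simp only: of_nat_eq_iff)
    hence "?X ^ j * (?X ^ 3) ^ tri (int j - int N) * ((?X ^ 2) ^ l * (?X ^ 3) ^ tri (int l - int N)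
        * (?X ^ 3) ^ tri (int i - int N)) = ?X ^ (3 * N) * (?X ^ ?e 1 j * (?X ^ ?e 2 l * ?X ^ ?e 0 i))"
      by (simp only: flip: power_add power_mult)
    hence "(?G j * (?G l * ?G i)) * (?X ^ j * (?X ^ 3) ^ tri (int j - int N) *
        ((?X ^ 2) ^ l * (?X ^ 3) ^ tri (int l - int N) * (?X ^ 3) ^ tri (int i - int N)))
      = (?G j * (?G l * ?G i)) * (?X ^ (3 * N) * (?X ^ ?e 1 j * (?X ^ ?e 2 l * ?X ^ ?e 0 i)))"
      by (simp only:)
    thus "(case p of (j, l) \<Rightarrow> ?X ^ j * coeff ?J j *
        ((?X ^ 2) ^ l * coeff ?J l * coeff ?J (3 * N - j - l))) = ?X ^ (3 * N) * ?t p"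
      unfolding p coeff_jacobi_poly i_def[symmetric] mult_2[symmetric] prod.case
      by (simp only: mult_ac)
  qed
  \<comment> \<open>Outside \<open>?T\<close> one of the three Gaussian binomials is zero.\<close>
  also have "\<dots> = (\<Sum>p\<in>?T. ?X ^ (3 * N) * ?t p)"
  proof -
    have "j \<le> 2 * N" if "?G j \<noteq> 0" for j
      using that qbinomial_eq_0[of "2 * N" j] by (meson not_le_imp_less)
    note this[dest!]
    show ?thesis
      by (intro sum.mono_neutral_right) auto
  qed
  also have "\<dots> = ?X ^ (3 * N) * (\<Sum>p\<in>?T. ?t p)"
    by (simp only: sum_distrib_left)
  finally have G: "qbinomial ?X (3 * N + 3 * N) (3 * N) = (\<Sum>p\<in>?T. ?t p)"
    by simp
  \<comment> \<open>One factor \<open>euler 3\<close> for each Gaussian binomial reduces every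
    summand to a pure power of \<open>q\<close>.\<close>
  have "eq_upto M (euler 3 ^ 3 * (\<Sum>p\<in>?T. ?t p)) (\<Sum>p\<in>?T. ?X ^ cubic_exp
      (int (fst p) - int N, int (snd p) - int N))"
    unfolding sum_distrib_left
  proof (rule eq_upto_sum)
    fix p assume "p \<in> ?T"
    then obtain j l where p: "p = (j, l)"
      and T: "j \<le> 2 * N" "l \<le> 2 * N" "N \<le> j + l" "j + l \<le> 3 * N"
      by auto
    define i where "i = 3 * N - j - l"
    have i: "int i - int N = - (int j - int N) - (int l - int N)" "i \<le> 2 * N"
      using T by (auto simp: i_def)
    have "eq_upto M ((euler 3 * (?G j * ?X ^ ?e 1 j)) * ((euler 3 * (?G l * ?X ^ ?e 2 l))
        * (euler 3 * (?G i * ?X ^ ?e 0 i)))) (?X ^ ?e 1 j * (?X ^ ?e 2 l * ?X ^ ?e 0 i))"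
      using T i(2) eq_upto_qbinomial_theta_exp[where N = N and s = 3]
      by (intro eq_upto_mult) (simp_all add: N_def)
    also have "?X ^ ?e 1 j * (?X ^ ?e 2 l * ?X ^ ?e 0 i)
        = ?X ^ cubic_exp (int j - int N, int l - int N)"
      unfolding cubic_exp_def i(1) prod.case by (simp only: power_add mult.assoc)
    finally show "eq_upto M (euler 3 ^ 3 * ?t p)
        (?X ^ cubic_exp (int (fst p) - int N, int (snd p) - int N))"
      unfolding p prod.case i_def[symmetric] by (simp only: power3_eq_cube mult_ac fst_conv snd_conv)
  qed
  also have "eq_upto M \<dots> cubic_theta"
    unfolding cubic_theta_def
  proof (rule eq_upto_counting_fps[OF fin, where \<phi> = "\<lambda>p. (int (fst p) - int N, int (snd p) - int N)"])
    fix y assume y: "cubic_exp y < M"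
    obtain b c where bc: "y = (b, c)" by (cases y)
    have "\<bar>b\<bar> \<le> int N" "\<bar>c\<bar> \<le> int N" "\<bar>- b - c\<bar> \<le> int N"
      using y int_theta_exp_bound(2)[of 3 1 b] int_theta_exp_bound(2)[of 3 2 c]
        int_theta_exp_bound(2)[of 3 0 "- b - c"]
      unfolding bc cubic_exp_def N_def by auto
    thus "y \<in> (\<lambda>p. (int (fst p) - int N, int (snd p) - int N)) ` ?T"
      unfolding bc by (intro image_eqI[of _ _ "(nat (b + int N), nat (c + int N))"]) auto
  qed (auto simp: inj_on_def)
  finally have 1: "eq_upto M (euler 3 ^ 3 * qbinomial ?X (3 * N + 3 * N) (3 * N)) cubic_theta"
    unfolding G .
  \<comment> \<open>The central Gaussian binomial itself tends to \<open>1 / euler 1\<close>, so its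
    two limits can be compared.\<close>
  have 2: "eq_upto M (euler 1 * qbinomial ?X (3 * N + 3 * N) (3 * N)) 1"
    using eq_upto_qbinomial[of 1 M "3 * N" "3 * N + 3 * N"] by (simp add: N_def)
  have "eq_upto M (cubic_theta * euler 1)
      (euler 3 ^ 3 * qbinomial ?X (3 * N + 3 * N) (3 * N) * euler 1)"
    by (intro eq_upto_mult 1[THEN eq_upto_sym]) auto
  also have "\<dots> = euler 3 ^ 3 * (euler 1 * qbinomial ?X (3 * N + 3 * N) (3 * N))"
    by (simp only: mult_ac)
  also have "eq_upto M \<dots> (euler 3 ^ 3 * 1)"
    by (intro eq_upto_mult 2) auto
  finally show "eq_upto M (cubic_theta * euler 1) (euler 3 ^ 3)"
    by simp
qed

section \<open>Product formulas for the two theta series of the 3-dissection\<close>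

lemma euler_trunc_mult_prod_plus:
  "euler_trunc k N * (\<Prod>i<N. 1 + fps_X ^ (k * Suc i)) = euler_trunc (2 * k) N"
proof -
  have "(1 - fps_X ^ (Suc i * k)) * (1 + fps_X ^ (k * Suc i)) = (1 - fps_X ^ (Suc i * (2 * k)) :: complex fps)" for i
  proof -
    have "fps_X ^ (Suc i * (2 * k)) = fps_X ^ (k * Suc i) * (fps_X ^ (k * Suc i) :: complex fps)"
      unfolding power_add[symmetric] by (intro arg_cong[of _ _ "power fps_X"]) simp
    thus ?thesis
      by (simp only: mult.commute[of "Suc i" k]) (simp add: algebra_simps)
  qed
  thus ?thesis
    unfolding euler_trunc_def prod.distrib[symmetric] by (simp only:)
qed

text \<open>\<open>theta 1 0\<close> is \<open>2 \<psi>\<close>, since \<open>k\<close> and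
  \<open>1 - k\<close> have the same exponent. On the product side the 2 is the factor
  \<open>1 + q ^ 0\<close>.\<close>

lemma theta_1_0_euler: "theta 1 0 * euler 1 = 2 * euler 2 ^ 2"
proof (rule fps_eq_if_eq_upto)
  fix M
  define N where "N = Suc M"
  let ?Q = "\<lambda>n. \<Prod>i<n. 1 + fps_X ^ (1 * Suc i) :: complex fps"
  have shift: "(\<Prod>i<N. 1 + fps_X ^ (1 * i + 0)) = 2 * ?Q M"
    unfolding N_def prod.lessThan_Suc_shift by simp
  have "eq_upto (N - 1) (theta 1 0)
      (euler 1 * (\<Prod>i<N. (1 + fps_X ^ (1 * i + 0)) * (1 + fps_X ^ (1 * Suc i - 0))))"
    by (intro jacobi_triple_product[THEN eq_upto_sym]) auto
  also have "(\<Prod>i<N. (1 + fps_X ^ (1 * i + 0)) * (1 + fps_X ^ (1 * Suc i - 0))) = 2 * ?Q M * ?Q N"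
    by (simp only: prod.distrib shift diff_zero)
  finally have "eq_upto M (theta 1 0 * euler 1) (euler 1 * (2 * ?Q M * ?Q N) * euler 1)"
    by (intro eq_upto_mult) (auto simp: N_def)
  also have "\<dots> = 2 * (euler 1 * ?Q M) * (euler 1 * ?Q N)"
    by (simp only: mult_ac)
  also have "eq_upto M \<dots> (2 * (euler_trunc 1 M * ?Q M) * (euler_trunc 1 N * ?Q N))"
    by (intro eq_upto_mult eq_upto_euler eq_upto_refl) (auto simp: N_def)
  also have "\<dots> = 2 * euler_trunc 2 M * euler_trunc 2 N"
    by (simp only: euler_trunc_mult_prod_plus mult_1_right)
  also have "eq_upto M \<dots> (2 * euler 2 * euler 2)"
    by (intro eq_upto_mult eq_upto_euler[THEN eq_upto_sym] eq_upto_refl) (auto simp: N_def)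
  finally show "eq_upto M (theta 1 0 * euler 1) (2 * euler 2 ^ 2)"
    by (simp only: power2_eq_square mult.assoc)
qed

text \<open>\<open>theta 3 1\<close> is the series \<open>A\<close>. Its triple product runs over
  the factors \<open>1 + q ^ n\<close> with \<open>n\<close> prime to 3, that is, the product over
  all \<open>n\<close> divided by that over the multiples of 3.\<close>

lemma theta_3_1_euler: "theta 3 1 * euler 1 * euler 6 = euler 2 * euler 3 ^ 2"
proof (rule fps_eq_if_eq_upto)
  fix M
  define N where "N = Suc M"
  let ?Q = "\<lambda>k n. \<Prod>i<n. 1 + fps_X ^ (k * Suc i) :: complex fps"
  define R where "R = (\<Prod>i<N. (1 + fps_X ^ (3 * i + 1)) * (1 + fps_X ^ (3 * Suc i - 1)) :: complex fps)"
  have Q: "?Q 1 (3 * N) = R * ?Q 3 N"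
    unfolding prod_lessThan_triple R_def prod.distrib[symmetric]
  proof (intro prod.cong refl)
    fix i :: nat
    have "1 * Suc (3 * i) = 3 * i + 1" "1 * Suc (3 * i + 1) = 3 * Suc i - 1"
      "1 * Suc (3 * i + 2) = 3 * Suc i"
      by simp_all
    thus "(1 + fps_X ^ (1 * Suc (3 * i))) * (1 + fps_X ^ (1 * Suc (3 * i + 1)))
        * (1 + fps_X ^ (1 * Suc (3 * i + 2)))
      = (1 + fps_X ^ (3 * i + 1)) * (1 + fps_X ^ (3 * Suc i - 1)) * (1 + fps_X ^ (3 * Suc i) :: complex fps)"
      by (simp only:)
  qed
  have Q1: "euler_trunc 1 (3 * N) * ?Q 1 (3 * N) = euler_trunc 2 (3 * N)"
    using euler_trunc_mult_prod_plus[of 1 "3 * N"] by simp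
  have Q3: "euler_trunc 3 N * ?Q 3 N = euler_trunc 6 N"
    using euler_trunc_mult_prod_plus[of 3 N] by simp
  have "euler_trunc 1 (3 * N) * R * euler_trunc 6 N
      = euler_trunc 1 (3 * N) * (R * ?Q 3 N) * euler_trunc 3 N"
    unfolding Q3[symmetric] by (simp only: mult_ac)
  also have "\<dots> = euler_trunc 2 (3 * N) * euler_trunc 3 N"
    unfolding Q[symmetric] Q1 ..
  finally have fin: "euler_trunc 1 (3 * N) * R * euler_trunc 6 N
      = euler_trunc 2 (3 * N) * euler_trunc 3 N" .
  have "eq_upto (N - 1) (euler 3 * R) (theta 3 1)"
    unfolding R_def by (intro jacobi_triple_product) auto
  hence "eq_upto M (theta 3 1 * euler 1 * euler 6) ((euler 3 * R) * euler_trunc 1 (3 * N) * euler_trunc 6 N)"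
    by (intro eq_upto_mult eq_upto_euler eq_upto_refl) (auto simp: N_def intro: eq_upto_sym)
  also have "\<dots> = euler 3 * (euler_trunc 1 (3 * N) * R * euler_trunc 6 N)"
    by (simp only: mult_ac)
  also have "\<dots> = euler 3 * (euler_trunc 2 (3 * N) * euler_trunc 3 N)"
    unfolding fin ..
  also have "eq_upto M \<dots> (euler 3 * (euler 2 * euler 3))"
    by (intro eq_upto_mult eq_upto_euler[THEN eq_upto_sym] eq_upto_refl) (auto simp: N_def)
  finally show "eq_upto M (theta 3 1 * euler 1 * euler 6) (euler 2 * euler 3 ^ 2)"
    by (simp only: power2_eq_square mult_ac)
qed

lemma dilate_counting_fps: "0 < k \<Longrightarrow> dilate k (counting_fps e) = counting_fps (\<lambda>x. k * e x)"
proof (rule fps_ext)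
  fix n assume k: "0 < k"
  have "{x. k * e x = n} = (if k dvd n then {x. e x = n div k} else {})"
    using k by auto
  thus "fps_nth (dilate k (counting_fps e)) n = fps_nth (counting_fps (\<lambda>x. k * e x)) n"
    using k by (simp add: dilate_nth)
qed

lemma X_mult_counting_fps: "fps_X * counting_fps e = counting_fps (\<lambda>x. Suc (e x))"
proof (rule fps_ext)
  fix n
  show "fps_nth (fps_X * counting_fps e) n = fps_nth (counting_fps (\<lambda>x. Suc (e x))) n"
    by (cases n) simp_all
qed

lemma finite_theta_exp_fibre:
  assumes "0 < s" "r \<le> s"
  shows "finite {k. theta_exp s r k = n}"
proof (rule finite_subset)
  show "{k. theta_exp s r k = n} \<subseteq> {- (int n + 1)..int n + 1}"
  proof
    fix k assume "k \<in> {k. theta_exp s r k = n}"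
    thus "k \<in> {- (int n + 1)..int n + 1}"
      using int_theta_exp_bound(2)[OF assms, of k] by auto
  qed
qed simp

section \<open>Dissections of theta series\<close>

text \<open>Sorts \<open>k\<close> modulo 3: the classes 0 and 1 are exchanged by
  \<open>k \<mapsto> 1 - k\<close> and give equal series, and the class 2 reproduces the original
  series in \<open>q ^ 9\<close>.\<close>

lemma theta_1_0_dissection:
  "theta 1 0 = 2 * dilate 3 (theta 3 1) + fps_X * dilate 9 (theta 1 0)"
proof (rule fps_ext)
  fix n
  let ?A = "{m. 3 * theta_exp 3 1 m = n}" and ?B = "{m. Suc (9 * theta_exp 1 0 m) = n}"
  have exps: "theta_exp 1 0 (3 * m) = 3 * theta_exp 3 1 m"
    "theta_exp 1 0 (1 - 3 * m) = 3 * theta_exp 3 1 m"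
    "theta_exp 1 0 (3 * m - 1) = Suc (9 * theta_exp 1 0 m)" for m
  proof -
    have "2 * int (theta_exp 1 0 (3 * m)) = 2 * int (3 * theta_exp 3 1 m)"
      "2 * int (theta_exp 1 0 (1 - 3 * m)) = 2 * int (3 * theta_exp 3 1 m)"
      "2 * int (theta_exp 1 0 (3 * m - 1)) = 2 * int (Suc (9 * theta_exp 1 0 m))"
      using int_tri[of m] int_tri[of "3 * m"] int_tri[of "1 - 3 * m"] int_tri[of "3 * m - 1"]
      by (simp_all add: int_theta_exp_bound(1) algebra_simps)
    thus "theta_exp 1 0 (3 * m) = 3 * theta_exp 3 1 m"
      "theta_exp 1 0 (1 - 3 * m) = 3 * theta_exp 3 1 m"
      "theta_exp 1 0 (3 * m - 1) = Suc (9 * theta_exp 1 0 m)"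
      by simp_all
  qed
  have fin: "finite {k. theta_exp 1 0 k = n}"
    by (rule finite_theta_exp_fibre) auto
  have split: "{k. theta_exp 1 0 k = n} =
    ((\<lambda>m. 3 * m) ` ?A \<union> (\<lambda>m. 1 - 3 * m) ` ?A) \<union> (\<lambda>m. 3 * m - 1) ` ?B"
  proof (intro equalityI subsetI)
    fix k assume k: "k \<in> {k. theta_exp 1 0 k = n}"
    have "\<exists>m. k = 3 * m \<or> k = 1 - 3 * m \<or> k = 3 * m - 1"
      by presburger
    thus "k \<in> ((\<lambda>m. 3 * m) ` ?A \<union> (\<lambda>m. 1 - 3 * m) ` ?A) \<union> (\<lambda>m. 3 * m - 1) ` ?B"
      using k by (auto simp: exps simp del: One_nat_def)
  qed (auto simp: exps simp del: One_nat_def)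
  have disj: "(\<lambda>m. 3 * m) ` ?A \<inter> (\<lambda>m. 1 - 3 * m) ` ?A = {}"
    "((\<lambda>m. 3 * m) ` ?A \<union> (\<lambda>m. 1 - 3 * m) ` ?A) \<inter> (\<lambda>m. 3 * m - 1) ` ?B = {}"
    by (auto; presburger)+
  have inj: "inj_on (\<lambda>m::int. 3 * m) S" "inj_on (\<lambda>m::int. 1 - 3 * m) S" "inj_on (\<lambda>m::int. 3 * m - 1) S" for S
    by (auto simp: inj_on_def)
  have "card {k. theta_exp 1 0 k = n} = 2 * card ?A + card ?B"
    using fin disj inj unfolding split
    by (subst card_Un_disjoint; (subst card_Un_disjoint)?) (auto simp: card_image)
  thus "fps_nth (theta 1 0) n
      = fps_nth (2 * dilate 3 (theta 3 1) + fps_X * dilate 9 (theta 1 0)) n"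
    unfolding theta_def mult_2 by (simp add: dilate_counting_fps X_mult_counting_fps)
qed

text \<open>The exponent is odd iff \<open>b\<close> is even and \<open>c\<close> is odd, and on this coset of the lattice it is
  again four times the original form plus one, after an affine change of variables.\<close>

lemma cubic_theta_odd:
  assumes "odd n"
  shows "fps_nth cubic_theta n = fps_nth (fps_X * dilate 4 cubic_theta) n"
proof -
  \<comment> \<open>At \<open>(2 * i, 2 * j - 1)\<close> the linear part would come out as
    \<open>- i - 2 * j\<close>; replacing \<open>(i, j)\<close> by \<open>(- i, - j)\<close>
    corrects its sign.\<close>
  let ?f = "\<lambda>(i, j). (- 2 * i, - 2 * j - 1) :: int \<times> int"
  have f: "cubic_exp (?f p) = Suc (4 * cubic_exp p)" for p
  proof -
    obtain i j where p: "p = (i, j)" by (cases p)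
    have "int (cubic_exp (?f p)) = int (Suc (4 * cubic_exp p))"
      unfolding p by (simp add: int_cubic_exp power2_eq_square algebra_simps)
    thus ?thesis by (simp only: of_nat_eq_iff)
  qed
  have "{p. cubic_exp p = n} = ?f ` {p. Suc (4 * cubic_exp p) = n}"
  proof (intro equalityI subsetI)
    fix p assume "p \<in> {p. cubic_exp p = n}"
    moreover obtain b c where p: "p = (b, c)" by (cases p)
    ultimately have n: "cubic_exp (b, c) = n" by simp
    hence "odd (3 * b\<^sup>2 + 3 * b * c + 3 * c\<^sup>2 + b + 2 * c)"
      using assms by (simp flip: int_cubic_exp)
    \<comment> \<open>Modulo 2 the form is \<open>c * (b + 1)\<close>.\<close>
    hence "odd c" "even b" by auto
    then obtain i' j' where "b = 2 * i'" "c = 2 * j' + 1"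
      by (elim evenE oddE)
    define i j where "i = - i'" and "j = - j' - 1"
    have "p = ?f (i, j)"
      using \<open>b = 2 * i'\<close> \<open>c = 2 * j' + 1\<close> by (simp add: p i_def j_def)
    moreover from this have "Suc (4 * cubic_exp (i, j)) = n"
      using f[of "(i, j)"] n p by simp
    ultimately show "p \<in> ?f ` {p. Suc (4 * cubic_exp p) = n}" by blast
  next
    fix p assume "p \<in> ?f ` {p. Suc (4 * cubic_exp p) = n}"
    then obtain p' where "p = ?f p'" "Suc (4 * cubic_exp p') = n"
      by blast
    thus "p \<in> {p. cubic_exp p = n}"
      using f[of p'] by simp
  qed
  moreover have "inj ?f" by (auto simp: inj_def)
  ultimately have "card {p. cubic_exp p = n} = card {p. Suc (4 * cubic_exp p) = n}"
    by (simp only: card_image[OF inj_on_subset[OF _ subset_UNIV]])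
  thus ?thesis
    unfolding cubic_theta_def by (simp add: dilate_counting_fps X_mult_counting_fps)
qed

section \<open>Norms of Euler products and an identity of level 6\<close>

lemma prod_lessThan_double:
  "(\<Prod>i<2 * N. f i) = (\<Prod>i<N. f (2 * i) * f (2 * i + 1))"
  for f :: "nat \<Rightarrow> 'a::comm_monoid_mult"
proof (induction N)
  case (Suc N)
  have "2 * Suc N = Suc (Suc (2 * N))" by simp
  thus ?case using Suc by (simp only: prod.lessThan_Suc mult.assoc) simp
qed simp

text \<open>The factors at \<open>q\<close> and \<open>- q\<close> pair to
  \<open>1 - q ^ (2 * m)\<close> for odd \<open>m\<close> and to a square for even \<open>m\<close>;
  \<open>euler (4 * k)\<close> supplies the factors \<open>1 - q ^ (2 * m)\<close> missing at even
  \<open>m\<close>.\<close>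

lemma euler_norm_2:
  assumes "odd k"
  shows "euler k * rescale (- 1) (euler k) * euler (4 * k) = euler (2 * k) ^ 3"
proof (rule fps_eq_if_eq_upto)
  fix M
  have k: "0 < k" using assms by (cases k) auto
  let ?X = "fps_X :: complex fps"
  define F where "F m = (1 - ?X ^ m) * (1 - fps_const ((- 1) ^ m) * ?X ^ m)" for m
  have F_odd: "F m = 1 - ?X ^ (2 * m)" if "odd m" for m
    using that unfolding F_def mult_2 power_add by (simp add: algebra_simps flip: fps_const_neg)
  have F_even: "F m = (1 - ?X ^ m) ^ 2" if "even m" for m
    using that unfolding F_def by (simp add: power2_eq_square)
  have "euler_trunc k (2 * M) * rescale (- 1) (euler_trunc k (2 * M)) * euler_trunc (4 * k) M
    = (\<Prod>j<2 * M. F (Suc j * k)) * euler_trunc (4 * k) M"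
    unfolding rescale_euler_trunc F_def prod.distrib by (simp only: euler_trunc_def)
  also have "\<dots> = (\<Prod>i<M. F (Suc (2 * i) * k) * F (Suc (2 * i + 1) * k) * (1 - ?X ^ (Suc i * (4 * k))))"
    by (simp only: prod_lessThan_double euler_trunc_def prod.distrib)
  also have "\<dots> = (\<Prod>i<M. ((1 - ?X ^ (Suc (2 * i) * (2 * k))) * (1 - ?X ^ (Suc (2 * i + 1) * (2 * k))))
      * (1 - ?X ^ (Suc i * (2 * k))) ^ 2)"
  proof (intro prod.cong refl)
    fix i
    have "F (Suc (2 * i) * k) = 1 - ?X ^ (2 * (Suc (2 * i) * k))"
      using assms by (intro F_odd) simp
    moreover have "F (Suc (2 * i + 1) * k) = (1 - ?X ^ (Suc (2 * i + 1) * k)) ^ 2"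
      by (intro F_even) simp
    moreover have "2 * (Suc (2 * i) * k) = Suc (2 * i) * (2 * k)" "Suc (2 * i + 1) * k = Suc i * (2 * k)"
      "Suc i * (4 * k) = Suc (2 * i + 1) * (2 * k)"
      by simp_all
    ultimately show "F (Suc (2 * i) * k) * F (Suc (2 * i + 1) * k) * (1 - ?X ^ (Suc i * (4 * k)))
      = ((1 - ?X ^ (Suc (2 * i) * (2 * k))) * (1 - ?X ^ (Suc (2 * i + 1) * (2 * k))))
        * (1 - ?X ^ (Suc i * (2 * k))) ^ 2"
      by (simp only: mult_ac)
  qed
  also have "\<dots> = euler_trunc (2 * k) (2 * M) * euler_trunc (2 * k) M ^ 2"
    unfolding euler_trunc_def prod_lessThan_double by (simp only: prod.distrib prod_power_distrib)
  finally have fin: "euler_trunc k (2 * M) * rescale (- 1) (euler_trunc k (2 * M)) * euler_trunc (4 * k) M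
    = euler_trunc (2 * k) (2 * M) * euler_trunc (2 * k) M ^ 2" .
  have "eq_upto M (euler k * rescale (- 1) (euler k) * euler (4 * k))
      (euler_trunc k (2 * M) * rescale (- 1) (euler_trunc k (2 * M)) * euler_trunc (4 * k) M)"
    using k by (intro eq_upto_mult eq_upto_euler eq_upto_rescale) auto
  also have "eq_upto M \<dots> (euler (2 * k) * euler (2 * k) ^ 2)"
    unfolding fin using k by (intro eq_upto_mult eq_upto_power eq_upto_euler[THEN eq_upto_sym]) auto
  finally show "eq_upto M (euler k * rescale (- 1) (euler k) * euler (4 * k)) (euler (2 * k) ^ 3)"
    by (simp add: eval_nat_numeral)
qed

text \<open>The hypothesis makes \<open>w\<close> a primitive cube root of unity. Exponents
  \<open>m\<close> prime to 3 give \<open>1 - q ^ (3 * m)\<close>, the others a cube, and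
  \<open>euler (9 * k)\<close> supplies the missing factors.\<close>

lemma euler_norm_3:
  assumes "\<not> 3 dvd k" and w: "w ^ 2 = - 1 - w"
  shows "euler k * rescale w (euler k) * rescale (w ^ 2) (euler k) * euler (9 * k) = euler (3 * k) ^ 4"
proof (rule fps_eq_if_eq_upto)
  fix M
  have k: "0 < k" using assms by (cases k) auto
  let ?X = "fps_X :: complex fps"
  have w3: "w ^ 3 = 1"
    using w by algebra
  have w6: "(w ^ 2) ^ 3 = 1"
    using w3 by (metis mult.commute power_mult power_one)
  define F where "F m = (1 - ?X ^ m) * (1 - fps_const (w ^ m) * ?X ^ m)
    * (1 - fps_const ((w ^ 2) ^ m) * ?X ^ m)" for m
  have F_dvd: "F m = (1 - ?X ^ m) ^ 3" if "3 dvd m" for m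
  proof -
    obtain t where t: "m = 3 * t" using \<open>3 dvd m\<close> by blast
    have "w ^ m = 1" "(w ^ 2) ^ m = 1"
      unfolding t by (simp_all only: power_mult w3 w6 power_one)
    thus ?thesis
      unfolding F_def by (simp add: power3_eq_cube)
  qed
  have F_ndvd: "F m = 1 - ?X ^ (3 * m)" if "\<not> 3 dvd m" for m
  proof -
    \<comment> \<open>For \<open>m\<close> prime to 3, \<open>w ^ m\<close> and
      \<open>(w ^ 2) ^ m\<close> are \<open>w\<close> and \<open>w ^ 2\<close> in some order, with
      sum \<open>- 1\<close> and product 1.\<close>
    define r where "r = m mod 3"
    have pw: "v ^ m = v ^ r" if "v ^ 3 = 1" for v :: complex
      using that unfolding r_def
      by (metis div_mult_mod_eq mult.commute mult_1 power_add power_mult power_one)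
    have "r = 1 \<or> r = 2" using that unfolding r_def by presburger
    hence "fps_const (w ^ m) + fps_const ((w ^ 2) ^ m) = - 1"
      "fps_const (w ^ m) * fps_const ((w ^ 2) ^ m) = 1"
      using w w3 w6 pw[OF w3] pw[OF w6]
      by (auto simp: eval_nat_numeral algebra_simps simp flip: fps_const_1_eq_1 fps_const_neg)
    moreover have "(1 - y) * (1 - a * y) * (1 - b * y) = 1 - y ^ 3" if "a + b = - 1" "a * b = 1"
      for a b y :: "complex fps"
    proof -
      have "(1 - y) * (1 - a * y) * (1 - b * y) = (1 - y) * (1 - (a + b) * y + a * b * y ^ 2)"
        by (simp add: algebra_simps power2_eq_square)
      also have "\<dots> = 1 - y ^ 3"
        unfolding that by (simp add: algebra_simps power2_eq_square power3_eq_cube)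
      finally show ?thesis .
    qed
    ultimately have "(1 - y) * (1 - fps_const (w ^ m) * y) * (1 - fps_const ((w ^ 2) ^ m) * y)
        = 1 - y ^ 3" for y
      by blast
    thus ?thesis
      unfolding F_def by (simp only: mult.commute[of 3] power_mult)
  qed
  have "euler_trunc k (3 * M) * rescale w (euler_trunc k (3 * M))
      * rescale (w ^ 2) (euler_trunc k (3 * M)) * euler_trunc (9 * k) M
    = (\<Prod>j<3 * M. F (Suc j * k)) * euler_trunc (9 * k) M"
    unfolding rescale_euler_trunc F_def prod.distrib by (simp only: euler_trunc_def)
  also have "\<dots> = (\<Prod>i<M. F (Suc (3 * i) * k) * F (Suc (3 * i + 1) * k) * F (Suc (3 * i + 2) * k)
      * (1 - ?X ^ (Suc i * (9 * k))))"
    by (simp only: prod_lessThan_triple euler_trunc_def prod.distrib)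
  also have "\<dots> = (\<Prod>i<M. ((1 - ?X ^ (Suc (3 * i) * (3 * k))) * (1 - ?X ^ (Suc (3 * i + 1) * (3 * k)))
      * (1 - ?X ^ (Suc (3 * i + 2) * (3 * k)))) * (1 - ?X ^ (Suc i * (3 * k))) ^ 3)"
  proof (intro prod.cong refl)
    fix i
    have nd: "\<not> 3 dvd Suc (3 * i) * k" "\<not> 3 dvd Suc (3 * i + 1) * k"
    proof -
      have "Suc (3 * i) * k = 3 * (i * k) + k" "Suc (3 * i + 1) * k = 3 * (i * k) + 2 * k"
        by (simp_all add: algebra_simps)
      moreover have "\<not> 3 dvd 3 * x + k" "\<not> 3 dvd 3 * x + 2 * k" for x
        using assms(1) by presburger+
      ultimately show "\<not> 3 dvd Suc (3 * i) * k" "\<not> 3 dvd Suc (3 * i + 1) * k"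
        by (simp_all only:) auto
    qed
    have "F (Suc (3 * i) * k) = 1 - ?X ^ (3 * (Suc (3 * i) * k))"
      "F (Suc (3 * i + 1) * k) = 1 - ?X ^ (3 * (Suc (3 * i + 1) * k))"
      using nd by (intro F_ndvd; simp)+
    moreover have "F (Suc (3 * i + 2) * k) = (1 - ?X ^ (Suc (3 * i + 2) * k)) ^ 3"
      by (intro F_dvd dvd_mult2) presburger
    moreover have "3 * (Suc (3 * i) * k) = Suc (3 * i) * (3 * k)"
      "3 * (Suc (3 * i + 1) * k) = Suc (3 * i + 1) * (3 * k)"
      "Suc (3 * i + 2) * k = Suc i * (3 * k)" "Suc i * (9 * k) = Suc (3 * i + 2) * (3 * k)"
      by simp_all
    ultimately show "F (Suc (3 * i) * k) * F (Suc (3 * i + 1) * k) * F (Suc (3 * i + 2) * k)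
      * (1 - ?X ^ (Suc i * (9 * k))) = ((1 - ?X ^ (Suc (3 * i) * (3 * k)))
      * (1 - ?X ^ (Suc (3 * i + 1) * (3 * k))) * (1 - ?X ^ (Suc (3 * i + 2) * (3 * k))))
      * (1 - ?X ^ (Suc i * (3 * k))) ^ 3"
      by (simp only: mult_ac)
  qed
  also have "\<dots> = euler_trunc (3 * k) (3 * M) * euler_trunc (3 * k) M ^ 3"
    unfolding euler_trunc_def prod_lessThan_triple by (simp only: prod.distrib prod_power_distrib)
  finally have fin: "euler_trunc k (3 * M) * rescale w (euler_trunc k (3 * M))
      * rescale (w ^ 2) (euler_trunc k (3 * M)) * euler_trunc (9 * k) M
    = euler_trunc (3 * k) (3 * M) * euler_trunc (3 * k) M ^ 3" .
  have "eq_upto M (euler k * rescale w (euler k) * rescale (w ^ 2) (euler k) * euler (9 * k))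
      (euler_trunc k (3 * M) * rescale w (euler_trunc k (3 * M))
      * rescale (w ^ 2) (euler_trunc k (3 * M)) * euler_trunc (9 * k) M)"
    using k by (intro eq_upto_mult eq_upto_euler eq_upto_rescale) auto
  also have "eq_upto M \<dots> (euler (3 * k) * euler (3 * k) ^ 3)"
    unfolding fin using k by (intro eq_upto_mult eq_upto_power eq_upto_euler[THEN eq_upto_sym]) auto
  finally show "eq_upto M (euler k * rescale w (euler k) * rescale (w ^ 2) (euler k) * euler (9 * k))
      (euler (3 * k) ^ 4)"
    by (simp add: eval_nat_numeral)
qed

text \<open>With \<open>A\<close> and \<open>B\<close> series in \<open>q\<^sup>3\<close>, the norm of \<open>A + q B\<close> over the substitutions \<open>q \<mapsto> w q\<close>,
  \<open>w\<^sup>3 = 1\<close>, is \<open>A\<^sup>3 + q\<^sup>3 B\<^sup>3\<close>; this is applied to the 3-dissection of \<open>theta 1 0\<close>.\<close>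

lemma level_6_identity:
  "euler 2 ^ 8 * euler 3 ^ 4 * euler 6
    = euler 1 * euler 2 ^ 3 * euler 3 ^ 9 + fps_X * euler 1 ^ 4 * euler 6 ^ 9"
proof -
  define w where "w = Complex (- 1 / 2) (sqrt 3 / 2)"
  have w: "w ^ 2 = - 1 - w"
    by (simp add: w_def complex_eq_iff power2_eq_square)
  have w3: "w ^ 3 = 1" "(w ^ 2) ^ 3 = 1"
    using w by algebra+
  define W W' where "W = fps_const w" and "W' = fps_const (w ^ 2)"
  have W: "W + W' = - 1" "W * W' = 1"
    using w w3 unfolding W_def W'_def
    by (simp_all add: eval_nat_numeral flip: fps_const_1_eq_1 fps_const_neg)
  define nrm where "nrm f = f * rescale w f * rescale (w ^ 2) f" for f
  have nrm_mult: "nrm (f * g) = nrm f * nrm g" and nrm_power: "nrm (f ^ m) = nrm f ^ m" for f g m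
    unfolding nrm_def rescale_hom by (simp_all only: power_mult_distrib mult_ac)
  have nrm_euler: "nrm (euler k) * euler (9 * k) = euler (3 * k) ^ 4" if "\<not> 3 dvd k" for k
    using euler_norm_3[OF that w] by (simp only: nrm_def)
  define D where "D = dilate 3 (theta 1 0)"
  define A where "A = dilate 3 (2 * theta 3 1)"
  define B where "B = dilate 3 D"
  have T: "theta 1 0 = A + fps_X * B"
    using theta_1_0_dissection by (simp add: A_def B_def D_def dilate_hom dilate_dilate)
  have r: "rescale v (theta 1 0) = A + fps_const v * fps_X * B" if "v ^ 3 = 1" for v
    using that unfolding T by (simp add: rescale_hom A_def B_def rescale_dilate)
  have "nrm (theta 1 0) = (A + fps_X * B) * (A + W * fps_X * B) * (A + W' * fps_X * B)"
    unfolding nrm_def r[OF w3(1)] r[OF w3(2)] W_def W'_def by (simp only: T)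
  also have "\<dots> = (A + fps_X * B) * (A ^ 2 + (W + W') * A * (fps_X * B) + W * W' * (fps_X * B) ^ 2)"
    by (simp add: algebra_simps power2_eq_square)
  also have "\<dots> = A ^ 3 + (fps_X * B) ^ 3"
    unfolding W by (simp add: algebra_simps power2_eq_square power3_eq_cube)
  also have "\<dots> = dilate 3 ((2 * theta 3 1) ^ 3 + fps_X * D ^ 3)"
    by (simp add: dilate_hom dilate_X A_def B_def power_mult_distrib)
  finally have nT: "nrm (theta 1 0) = dilate 3 ((2 * theta 3 1) ^ 3 + fps_X * D ^ 3)" .
  have n2: "nrm 2 = 2 ^ 3"
    by (simp add: nrm_def rescale_def)
  \<comment> \<open>A second evaluation of the same norm, now from the product formula.\<close>
  have "nrm (theta 1 0) * nrm (euler 1) = 2 ^ 3 * nrm (euler 2) ^ 2"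
    using arg_cong[OF theta_1_0_euler, of nrm] by (simp only: nrm_mult nrm_power n2)
  hence "nrm (theta 1 0) * (nrm (euler 1) * euler (9 * 1)) * euler (9 * 2) ^ 2
      = 2 ^ 3 * (nrm (euler 2) * euler (9 * 2)) ^ 2 * euler (9 * 1)"
    by algebra
  moreover have n: "nrm (euler 1) * euler (9 * 1) = euler 3 ^ 4" "nrm (euler 2) * euler (9 * 2) = euler 6 ^ 4"
    using nrm_euler[of 1] nrm_euler[of 2] by simp_all
  ultimately have "nrm (theta 1 0) * euler 3 ^ 4 * euler (9 * 2) ^ 2 = 2 ^ 3 * (euler 6 ^ 4) ^ 2 * euler (9 * 1)"
    by (simp only: n)
  hence "nrm (theta 1 0) * euler 3 ^ 4 * euler 18 ^ 2 = 2 ^ 3 * euler 6 ^ 8 * euler 9"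
    by (simp flip: power_mult)
  \<comment> \<open>Both evaluations are series in \<open>q ^ 3\<close>, so \<open>q ^ 3\<close> may
    be replaced by \<open>q\<close>.\<close>
  hence "dilate 3 (((2 * theta 3 1) ^ 3 + fps_X * D ^ 3) * euler 1 ^ 4 * euler 6 ^ 2)
      = dilate 3 (2 ^ 3 * euler 2 ^ 8 * euler 3)"
    unfolding nT by (simp add: dilate_hom dilate_euler)
  hence *: "((2 * theta 3 1) ^ 3 + fps_X * D ^ 3) * euler 1 ^ 4 * euler 6 ^ 2
      = 2 ^ 3 * euler 2 ^ 8 * euler 3"
    by (rule dilate_inj[rotated]) simp
  have D: "D * euler 3 = 2 * euler 6 ^ 2"
    using arg_cong[OF theta_1_0_euler, of "dilate 3"]
    by (simp add: dilate_hom dilate_euler D_def)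
  have "2 ^ 3 * (euler 2 ^ 8 * euler 3 ^ 4 * euler 6)
      = (((2 * theta 3 1) ^ 3 + fps_X * D ^ 3) * euler 1 ^ 4 * euler 6 ^ 2) * euler 3 ^ 3 * euler 6"
    unfolding * by algebra
  also have "\<dots> = 2 ^ 3 * (theta 3 1 * euler 1 * euler 6) ^ 3 * euler 1 * euler 3 ^ 3
      + fps_X * (D * euler 3) ^ 3 * euler 1 ^ 4 * euler 6 ^ 3"
    by algebra
  also have "\<dots> = 2 ^ 3 * (euler 1 * euler 2 ^ 3 * euler 3 ^ 9 + fps_X * euler 1 ^ 4 * euler 6 ^ 9)"
    unfolding theta_3_1_euler D by algebra
  finally show ?thesis
    by (simp only: mult_cancel_left) auto
qed

section \<open>Odd parts and the dissection of the generating function\<close>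

definition odd_part :: "complex fps \<Rightarrow> complex fps" where
  "odd_part f = Abs_fps (\<lambda>n. fps_nth f (2 * n + 1))"

text \<open>Taking odd parts is linear over series in \<open>q ^ 2\<close>, so an even denominator
  can stay on the left and no quotient has to be formed.\<close>

lemma odd_part_unique:
  assumes "dilate 2 u * f = dilate 2 x + fps_X * dilate 2 y"
  shows "u * odd_part f = y"
proof -
  have odd_nth: "fps_nth (dilate 2 x + fps_X * dilate 2 y) (2 * n + 1) = fps_nth y n" for x y n
    by (simp add: dilate_nth)
  define g where "g = Abs_fps (\<lambda>n. fps_nth f (2 * n))"
  have "f = dilate 2 g + fps_X * dilate 2 (odd_part f)"
  proof (rule fps_ext)
    fix n
    show "fps_nth f n = fps_nth (dilate 2 g + fps_X * dilate 2 (odd_part f)) n"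
    proof (cases "even n")
      case True
      thus ?thesis
        by (cases n) (auto simp: dilate_nth g_def elim!: evenE)
    next
      case False
      then obtain m where "n = 2 * m + 1" by (elim oddE)
      thus ?thesis by (simp only: odd_nth) (simp add: odd_part_def)
    qed
  qed
  hence "dilate 2 u * f = dilate 2 (u * g) + fps_X * dilate 2 (u * odd_part f)"
    by (metis dilate_hom(3) distrib_left mult.left_commute pos2)
  hence "dilate 2 (u * g) + fps_X * dilate 2 (u * odd_part f) = dilate 2 x + fps_X * dilate 2 y"
    using assms by simp
  thus ?thesis
    using odd_nth by (metis fps_ext)
qed

section \<open>The generating function of regular partitions\<close>

definition parts_fps :: "nat set \<Rightarrow> complex fps" where
  "parts_fps S = Abs_fps (\<lambda>n. of_nat (card {P. set_mset P \<subseteq> S \<and> sum_mset P = n}))"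

lemma finite_partitions: "0 \<notin> S \<Longrightarrow> finite {P. set_mset P \<subseteq> S \<and> sum_mset P = n}" for n :: nat
  \<comment> \<open>Modulus 0 excludes only the part 0, so these are all partitions of
    \<open>n\<close>.\<close>
  by (rule finite_subset[OF _ finite_regular_partitions[of 0 n]])
    (auto simp: regular_partitions_def intro: gr0I)

text \<open>Either \<open>k\<close> does not occur, or one copy of it can be removed.\<close>

lemma parts_fps_insert:
  assumes "0 \<notin> insert k S" "k \<notin> S"
  shows "parts_fps (insert k S) = parts_fps S + fps_X ^ k * parts_fps (insert k S)"
proof (rule fps_ext)
  fix n
  let ?A = "\<lambda>S n. {P. set_mset P \<subseteq> S \<and> sum_mset P = n}"
  have split: "?A (insert k S) n = ?A S n \<union> (if k \<le> n then add_mset k ` ?A (insert k S) (n - k) else {})"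
  proof (intro equalityI subsetI)
    fix P assume P: "P \<in> ?A (insert k S) n"
    show "P \<in> ?A S n \<union> (if k \<le> n then add_mset k ` ?A (insert k S) (n - k) else {})"
    proof (cases "k \<in># P")
      case True
      then obtain Q where "P = add_mset k Q" by (metis multi_member_split)
      thus ?thesis using P by auto
    next
      case False
      thus ?thesis using P by auto
    qed
  qed (auto split: if_splits)
  have "card (?A (insert k S) n) = card (?A S n) + card (if k \<le> n then add_mset k ` ?A (insert k S) (n - k) else {})"
    unfolding split
  proof (rule card_Un_disjoint)
    show "finite (?A S n)"
      using assms(1) by (intro finite_partitions) simp
    show "finite (if k \<le> n then add_mset k ` ?A (insert k S) (n - k) else {})"
      using finite_partitions[OF assms(1)] by simp
    show "?A S n \<inter> (if k \<le> n then add_mset k ` ?A (insert k S) (n - k) else {}) = {}"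
    proof -
      have "?A S n \<inter> add_mset k ` B = {}" for B
        using assms(2) by auto
      thus ?thesis by (cases "k \<le> n") (simp_all only: if_True if_False Int_empty_right)
    qed
  qed
  also have "card (if k \<le> n then add_mset k ` ?A (insert k S) (n - k) else {})
      = (if k \<le> n then card (?A (insert k S) (n - k)) else 0)"
    by (simp add: card_image inj_on_def)
  finally show "fps_nth (parts_fps (insert k S)) n
      = fps_nth (parts_fps S + fps_X ^ k * parts_fps (insert k S)) n"
    by (simp add: parts_fps_def fps_X_power_mult_nth)
qed

lemma parts_fps_mult_prod:
  "finite S \<Longrightarrow> 0 \<notin> S \<Longrightarrow> parts_fps S * (\<Prod>k\<in>S. 1 - fps_X ^ k) = 1"
proof (induction S rule: finite_induct)
  case empty
  have "{P. P = {#} \<and> sum_mset P = n} = (if n = 0 then {{#}} else {})" for n :: nat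
    by auto
  thus ?case by (auto simp: parts_fps_def fps_eq_iff)
next
  case (insert k S)
  have "parts_fps (insert k S) * (1 - fps_X ^ k) = parts_fps S"
    using parts_fps_insert[of k S] insert by (simp add: algebra_simps)
  thus ?case
    using insert by (simp add: mult.assoc[symmetric])
qed

lemma regular_partitions_fps:
  assumes "0 < m"
  shows "Abs_fps (\<lambda>n. of_nat (b_reg m n)) * euler 1 = euler m"
proof (rule fps_eq_if_eq_upto)
  fix N
  \<comment> \<open>Parts below \<open>N\<close> would suffice for the coefficients; with the bound
    \<open>m * N\<close> the remaining numbers up to it are exactly \<open>m, 2m, ..., N m\<close>,
    the exponents of \<open>euler_trunc m N\<close>.\<close>
  define S where "S = {k \<in> {1..m * N}. \<not> m dvd k}"
  have "eq_upto N (Abs_fps (\<lambda>n. of_nat (b_reg m n))) (parts_fps S)"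
    unfolding eq_upto_def
  proof (intro allI impI)
    fix n assume n: "n < N"
    have "regular_partitions m n = {P. set_mset P \<subseteq> S \<and> sum_mset P = n}"
    proof (intro equalityI subsetI)
      fix P assume P: "P \<in> regular_partitions m n"
      have "k \<in> S" if "k \<in># P" for k
      proof -
        have "k \<le> sum_mset P"
          using that by (metis le_add1 multi_member_split sum_mset.add_mset)
        also have "\<dots> \<le> m * N"
          using P n assms by (cases m) (auto simp: regular_partitions_def)
        finally show ?thesis
          using P that by (auto simp: S_def regular_partitions_def Suc_le_eq)
      qed
      thus "P \<in> {P. set_mset P \<subseteq> S \<and> sum_mset P = n}"
        using P by (auto simp: regular_partitions_def)
    qed (auto simp: regular_partitions_def S_def)
    thus "fps_nth (Abs_fps (\<lambda>n. of_nat (b_reg m n))) n = fps_nth (parts_fps S) n"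
      by (simp add: b_reg_def parts_fps_def)
  qed
  hence "eq_upto N (Abs_fps (\<lambda>n. of_nat (b_reg m n)) * euler 1) (parts_fps S * euler_trunc 1 (m * N))"
    using assms by (intro eq_upto_mult eq_upto_euler) auto
  also have "euler_trunc 1 (m * N) = (\<Prod>k\<in>{1..m * N}. 1 - fps_X ^ k)"
    unfolding euler_trunc_def
    by (intro prod.reindex_bij_witness[of _ "\<lambda>k. k - 1" Suc]) auto
  also have "{1..m * N} = S \<union> (\<lambda>j. m * Suc j) ` {..<N}"
  proof (intro equalityI subsetI)
    fix k assume k: "k \<in> {1..m * N}"
    show "k \<in> S \<union> (\<lambda>j. m * Suc j) ` {..<N}"
    proof (cases "m dvd k")
      case True
      then obtain j where j: "k = m * j" by blast
      with k obtain i where i: "j = Suc i" by (cases j) auto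
      have "Suc i \<le> N"
        using k assms unfolding j i by (simp del: mult_Suc_right)
      thus ?thesis unfolding j i by auto
    next
      case False
      thus ?thesis using k by (simp add: S_def)
    qed
  next
    fix k assume "k \<in> S \<union> (\<lambda>j. m * Suc j) ` {..<N}"
    thus "k \<in> {1..m * N}"
      using assms by (auto simp: S_def simp del: mult_Suc_right)
  qed
  also have "(\<Prod>k\<in>\<dots>. 1 - fps_X ^ k) = (\<Prod>k\<in>S. 1 - fps_X ^ k)
      * (\<Prod>k\<in>(\<lambda>j. m * Suc j) ` {..<N}. 1 - fps_X ^ k :: complex fps)"
    by (intro prod.union_disjoint) (auto simp: S_def)
  also have "(\<Prod>k\<in>(\<lambda>j. m * Suc j) ` {..<N}. 1 - fps_X ^ k) = euler_trunc m N"
    unfolding euler_trunc_def using assms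
    by (subst prod.reindex) (auto simp: inj_on_def mult.commute simp del: mult_Suc_right mult_Suc)
  also have "parts_fps S * ((\<Prod>k\<in>S. 1 - fps_X ^ k) * euler_trunc m N) = euler_trunc m N"
    using parts_fps_mult_prod[of S] by (simp add: S_def flip: mult.assoc)
  also have "eq_upto N \<dots> (euler m)"
    using assms by (intro eq_upto_euler[THEN eq_upto_sym]) auto
  finally show "eq_upto N (Abs_fps (\<lambda>n. of_nat (b_reg m n)) * euler 1) (euler m)" .
qed

section \<open>The 2-dissections and the two extractions of odd parts\<close>

lemma cubic_theta_even_odd:
  obtains e where "cubic_theta = dilate 2 e + fps_X * dilate 4 cubic_theta"
proof
  define E where "E = cubic_theta - fps_X * dilate 4 cubic_theta"
  define e where "e = Abs_fps (\<lambda>n. fps_nth E (2 * n))"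
  have "E = dilate 2 e"
  proof (rule fps_ext)
    fix n
    show "fps_nth E n = fps_nth (dilate 2 e) n"
      using cubic_theta_odd[of n] by (cases "even n") (auto simp: dilate_nth e_def E_def)
  qed
  thus "cubic_theta = dilate 2 e + fps_X * dilate 4 cubic_theta"
    by (simp add: E_def algebra_simps)
qed

text \<open>With \<open>E = dilate 2 e\<close> and \<open>O = fps_X * dilate 4 cubic_theta\<close>,
  the second clause is the product formula for \<open>E\<close> and the third the 2-dissection of
  \<open>f\<^sub>3/f\<^sub>1\<^sup>3\<close>, both with denominators cleared.\<close>

lemma cubic_theta_dissection:
  obtains e where
    "cubic_theta = dilate 2 e + fps_X * dilate 4 cubic_theta"
    "dilate 2 e * euler 2 ^ 2 * euler 12 = euler 4 ^ 3 * euler 6 ^ 2"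
    "euler 2 ^ 5 * euler 3 * euler 6
      = euler 1 ^ 3 * (dilate 2 e ^ 2 + 3 * (fps_X * (dilate 2 e * dilate 4 cubic_theta)))"
proof -
  obtain e where e: "cubic_theta = dilate 2 e + fps_X * dilate 4 cubic_theta"
    by (rule cubic_theta_even_odd)
  define C where "C = cubic_theta"
  define E where "E = dilate 2 e"
  define Q where "Q = fps_X * dilate 4 cubic_theta"
  note nz = euler_nonzero
  have C: "C = E + Q"
    using e by (simp add: C_def E_def Q_def)
  have C1: "C * euler 1 = euler 3 ^ 3"
    using euler_cubic_theta by (simp add: C_def)
  have Q4: "Q * euler 4 = fps_X * euler 12 ^ 3"
    using arg_cong[OF euler_cubic_theta, of "dilate 4"]
    by (simp add: Q_def dilate_hom dilate_euler mult.assoc)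
  have S: "rescale (- 1) C = E - Q"
    unfolding C by (simp add: rescale_hom E_def Q_def rescale_dilate flip: fps_const_neg)
  have "(E - Q) * rescale (- 1) (euler 1) = rescale (- 1) (euler 3) ^ 3"
    using arg_cong[OF C1, of "rescale (- 1)"] by (simp only: rescale_hom S)
  moreover have "euler 1 * rescale (- 1) (euler 1) * euler 4 = euler 2 ^ 3"
    "euler 3 * rescale (- 1) (euler 3) * euler 12 = euler 6 ^ 3"
    using euler_norm_2[of 1] euler_norm_2[of 3] by simp_all
  \<comment> \<open>\<open>r\<close> and \<open>s\<close> stand for \<open>euler 1\<close> and
    \<open>euler 3\<close> at \<open>- q\<close>. The extra \<open>euler 3 ^ 3\<close> completes the
    norm of \<open>euler 3\<close> and is cancelled below.\<close>
  moreover have "((E - Q) * C * euler 2 ^ 3 * euler 12 ^ 3) * euler 3 ^ 3 = (euler 6 ^ 9 * euler 4) * euler 3 ^ 3"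
    if "(E - Q) * r = s ^ 3" "euler 1 * r * euler 4 = euler 2 ^ 3" "euler 3 * s * euler 12 = euler 6 ^ 3"
    for r s
  proof -
    have "((E - Q) * C * euler 2 ^ 3 * euler 12 ^ 3) * euler 3 ^ 3
        = ((E - Q) * r) * (C * euler 1) * euler 12 ^ 3 * euler 4 * euler 3 ^ 3"
      unfolding that(2)[symmetric] by algebra
    also have "\<dots> = (euler 3 * s * euler 12) ^ 3 * euler 4 * euler 3 ^ 3"
      unfolding that(1) C1 by algebra
    also have "\<dots> = (euler 6 ^ 9 * euler 4) * euler 3 ^ 3"
      unfolding that(3) by algebra
    finally show ?thesis .
  qed
  ultimately have "((E - Q) * C * euler 2 ^ 3 * euler 12 ^ 3) * euler 3 ^ 3
      = (euler 6 ^ 9 * euler 4) * euler 3 ^ 3"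
    by blast
  hence diff: "(E - Q) * C * euler 2 ^ 3 * euler 12 ^ 3 = euler 6 ^ 9 * euler 4"
    using nz[of 3] by simp
  have I2: "euler 4 ^ 8 * euler 6 ^ 4 * euler 12
      = euler 2 * euler 4 ^ 3 * euler 6 ^ 9 + fps_X ^ 2 * euler 2 ^ 4 * euler 12 ^ 9"
    using arg_cong[OF level_6_identity, of "dilate 2"]
    by (simp add: dilate_hom dilate_euler dilate_X)
  \<comment> \<open>\<open>E ^ 2 = (E - Q) * (E + Q) + Q ^ 2\<close>; the two summands become the
    two terms of the level 6 identity at \<open>q ^ 2\<close>.\<close>
  have "(E * euler 2 ^ 2 * euler 12) ^ 2 * (euler 12 * euler 4 ^ 2)
      = euler 2 * euler 4 ^ 2 * ((E - Q) * C * euler 2 ^ 3 * euler 12 ^ 3)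
        + (Q * euler 4) ^ 2 * euler 2 ^ 4 * euler 12 ^ 3"
    unfolding C by algebra
  also have "\<dots> = euler 4 ^ 8 * euler 6 ^ 4 * euler 12"
    unfolding diff Q4 I2 by algebra
  also have "\<dots> = (euler 4 ^ 3 * euler 6 ^ 2) ^ 2 * (euler 12 * euler 4 ^ 2)"
    by algebra
  finally have "(E * euler 2 ^ 2 * euler 12) ^ 2 = (euler 4 ^ 3 * euler 6 ^ 2) ^ 2"
    using nz[of 12] nz[of 4] by simp
  \<comment> \<open>The sign of the square root is read off the constant coefficient.\<close>
  moreover have "E * euler 2 ^ 2 * euler 12 \<noteq> - (euler 4 ^ 3 * euler 6 ^ 2)"
  proof
    have "fps_nth C 0 = 1"
      using arg_cong[OF C1, of "\<lambda>f. fps_nth f 0"] by (simp add: euler_nth_0 fps_nth_power_0)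
    hence "fps_nth E 0 = 1"
      using C by (simp add: Q_def)
    moreover assume "E * euler 2 ^ 2 * euler 12 = - (euler 4 ^ 3 * euler 6 ^ 2)"
    ultimately show False
      by (auto dest!: arg_cong[of _ _ "\<lambda>f. fps_nth f 0"] simp: euler_nth_0 fps_nth_power_0)
  qed
  ultimately have E: "E * euler 2 ^ 2 * euler 12 = euler 4 ^ 3 * euler 6 ^ 2"
    unfolding power2_eq_iff by blast
  \<comment> \<open>Rewrites \<open>fps_X * euler 6 ^ 9\<close>, hence the second term of the level
    6 identity, through \<open>E\<close> and \<open>Q\<close>.\<close>
  have "((E - Q) * C * Q * euler 2 ^ 3) * (euler 12 ^ 3 * euler 4)
      = ((E - Q) * C * euler 2 ^ 3 * euler 12 ^ 3) * (Q * euler 4)"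
    by algebra
  also have "\<dots> = (fps_X * euler 6 ^ 9) * (euler 12 ^ 3 * euler 4)"
    unfolding diff Q4 by algebra
  finally have Xe: "(E - Q) * C * Q * euler 2 ^ 3 = fps_X * euler 6 ^ 9"
    using nz[of 12] nz[of 4] by simp
  \<comment> \<open>The level 6 identity at \<open>q\<close>: every term now contains
    \<open>C * euler 1 * euler 2 ^ 3\<close>, and what remains is a polynomial in \<open>E\<close>
    and \<open>Q\<close>.\<close>
  have "(euler 2 ^ 5 * euler 3 * euler 6) * (C * euler 1 * euler 2 ^ 3) = euler 2 ^ 8 * euler 3 ^ 4 * euler 6"
    unfolding C1 by algebra
  also have "\<dots> = euler 1 * euler 2 ^ 3 * (C * euler 1) ^ 3 + ((E - Q) * C * Q * euler 2 ^ 3) * euler 1 ^ 4"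
    unfolding level_6_identity C1 Xe by algebra
  also have "\<dots> = (euler 1 ^ 3 * (C ^ 2 + (E - Q) * Q)) * (C * euler 1 * euler 2 ^ 3)"
    by algebra
  also have "C ^ 2 + (E - Q) * Q = E ^ 2 + 3 * (E * Q)"
    unfolding C by algebra
  finally have "euler 2 ^ 5 * euler 3 * euler 6 = euler 1 ^ 3 * (E ^ 2 + 3 * (E * Q))"
    using nz[of 1] nz[of 2] nz[of 3] C1 by auto
  moreover have "E * Q = fps_X * (E * dilate 4 cubic_theta)"
    by (simp add: Q_def)
  ultimately show ?thesis
    using that e E unfolding E_def by simp
qed

lemma odd_odd_part_regular_9:
  fixes G :: "complex fps"
  assumes G: "G * euler 1 = euler 9"
  shows "odd_part (odd_part G) * euler 1 ^ 5 = 3 * (euler 2 ^ 2 * euler 6 ^ 2 * euler 9)"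
proof -
  note nz = euler_nonzero
  obtain e where e: "cubic_theta = dilate 2 e + fps_X * dilate 4 cubic_theta"
    "dilate 2 e * euler 2 ^ 2 * euler 12 = euler 4 ^ 3 * euler 6 ^ 2"
    "euler 2 ^ 5 * euler 3 * euler 6
      = euler 1 ^ 3 * (dilate 2 e ^ 2 + 3 * (fps_X * (dilate 2 e * dilate 4 cubic_theta)))"
    by (rule cubic_theta_dissection)
  have Dk: "dilate k cubic_theta * euler k = euler (3 * k) ^ 3" if "0 < k" for k
    using arg_cong[OF euler_cubic_theta, of "dilate k"] that
    by (simp add: dilate_hom dilate_euler mult.commute)
  have a3: "dilate 3 (theta 3 1) * euler 3 * euler 18 = euler 6 * euler 9 ^ 2"
    using arg_cong[OF theta_3_1_euler, of "dilate 3"] by (simp add: dilate_hom dilate_euler)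
  have t9: "dilate 9 (theta 1 0) * euler 9 = 2 * euler 18 ^ 2"
    using arg_cong[OF theta_1_0_euler, of "dilate 9"] by (simp add: dilate_hom dilate_euler)
  \<comment> \<open>The 3-dissection of \<open>\<psi>\<close> in Euler products. It is used twice:
    for \<open>G\<close> and, in reverse, for its odd part.\<close>
  have "2 * (euler 2 ^ 2 * euler 3 * euler 9 * euler 18)
      = (theta 1 0 * euler 1) * euler 3 * euler 9 * euler 18"
    unfolding theta_1_0_euler by algebra
  also have "\<dots> = 2 * (dilate 3 (theta 3 1) * euler 3 * euler 18) * euler 1 * euler 9
      + fps_X * (dilate 9 (theta 1 0) * euler 9) * euler 1 * euler 3 * euler 18"
    by (subst theta_1_0_dissection) algebra
  also have "\<dots> = 2 * (euler 1 * (euler 6 * euler 9 ^ 3 + fps_X * euler 3 * euler 18 ^ 3))"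
    unfolding a3 t9 by algebra
  finally have psi: "euler 2 ^ 2 * euler 3 * euler 9 * euler 18
      = euler 1 * (euler 6 * euler 9 ^ 3 + fps_X * euler 3 * euler 18 ^ 3)"
    by simp
  \<comment> \<open>Except for \<open>dilate 3 cubic_theta\<close> and the explicit
    \<open>fps_X\<close>, the resulting formula for \<open>G\<close> involves only even
    series.\<close>
  have "(euler 2 ^ 2 * euler 18 * G) * (euler 1 * euler 3)
      = euler 2 ^ 2 * euler 3 * euler 18 * (G * euler 1)"
    by algebra
  also have "\<dots> = euler 1 * (euler 6 * (dilate 3 cubic_theta * euler 3) + fps_X * euler 3 * euler 18 ^ 3)"
    unfolding G using psi Dk[of 3] by (simp add: mult_ac)
  also have "\<dots> = (euler 6 * dilate 3 cubic_theta + fps_X * euler 18 ^ 3) * (euler 1 * euler 3)"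
    by algebra
  finally have G1: "euler 2 ^ 2 * euler 18 * G = euler 6 * dilate 3 cubic_theta + fps_X * euler 18 ^ 3"
    using nz[of 1] nz[of 3] by simp
  have D3: "dilate 3 cubic_theta = dilate 2 (dilate 3 e) + fps_X ^ 3 * dilate 2 (dilate 6 cubic_theta)"
    by (subst e(1)) (simp add: dilate_hom dilate_X dilate_dilate)
  have "dilate 2 (euler 1 ^ 2 * euler 9) * G = dilate 2 (euler 3 * dilate 3 e)
      + fps_X * dilate 2 (euler 9 ^ 3 + fps_X * euler 3 * dilate 6 cubic_theta)"
  proof -
    have "dilate 2 (euler 1 ^ 2 * euler 9) * G = euler 2 ^ 2 * euler 18 * G"
      by (simp add: dilate_hom dilate_euler)
    also have "\<dots> = euler 6 * dilate 2 (dilate 3 e)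
        + fps_X * (euler 18 ^ 3 + fps_X ^ 2 * euler 6 * dilate 2 (dilate 6 cubic_theta))"
      unfolding G1 D3 by algebra
    also have "\<dots> = dilate 2 (euler 3 * dilate 3 e)
      + fps_X * dilate 2 (euler 9 ^ 3 + fps_X * euler 3 * dilate 6 cubic_theta)"
      by (simp add: dilate_hom dilate_euler dilate_X)
    finally show ?thesis .
  qed
  hence H: "euler 1 ^ 2 * euler 9 * odd_part G = euler 9 ^ 3 + fps_X * euler 3 * dilate 6 cubic_theta"
    by (rule odd_part_unique)
  define K where "K = odd_part G"
  \<comment> \<open>The bracket of \<open>psi\<close> reappears in the odd part, so the sum
    collapses to a single product.\<close>
  have "(K * euler 1 ^ 3 * euler 6) * euler 9 = (euler 1 ^ 2 * euler 9 * K) * euler 1 * euler 6"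
    by algebra
  also have "\<dots> = euler 1 * (euler 6 * euler 9 ^ 3 + fps_X * euler 3 * (dilate 6 cubic_theta * euler 6))"
    unfolding H[folded K_def] by algebra
  also have "\<dots> = (euler 2 ^ 2 * euler 3 * euler 18) * euler 9"
    using psi Dk[of 6] by (simp add: mult_ac)
  finally have K: "K * euler 1 ^ 3 * euler 6 = euler 2 ^ 2 * euler 3 * euler 18"
    using nz[of 9] by simp
  let ?Y = "dilate 2 e ^ 2 + 3 * (fps_X * (dilate 2 e * dilate 4 cubic_theta))"
  \<comment> \<open>Apart from \<open>euler 3 / euler 1 ^ 3\<close>, the product for
    \<open>K\<close> is even; inserting the 2-dissection of this quotient exposes its odd
    part.\<close>
  have "(euler 6 ^ 2 * euler 2 ^ 3 * K) * (euler 1 ^ 3 * euler 2 ^ 2)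
      = (K * euler 1 ^ 3 * euler 6) * euler 2 ^ 5 * euler 6"
    by algebra
  also have "\<dots> = euler 18 * (euler 2 ^ 5 * euler 3 * euler 6) * euler 2 ^ 2"
    unfolding K by algebra
  also have "\<dots> = (euler 18 * ?Y) * (euler 1 ^ 3 * euler 2 ^ 2)"
    unfolding e(3) by algebra
  finally have K2: "euler 6 ^ 2 * euler 2 ^ 3 * K = euler 18 * ?Y"
    using nz[of 1] nz[of 2] by simp
  have "dilate 2 (euler 3 ^ 2 * euler 1 ^ 3) * K = dilate 2 (euler 9 * e ^ 2)
      + fps_X * dilate 2 (3 * euler 9 * e * dilate 2 cubic_theta)"
  proof -
    have "dilate 2 (euler 3 ^ 2 * euler 1 ^ 3) * K = euler 18 * ?Y"
      using K2 by (simp add: dilate_hom dilate_euler)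
    also have "\<dots> = euler 18 * dilate 2 e ^ 2 + fps_X * (3 * euler 18 * dilate 2 e * dilate 4 cubic_theta)"
      by algebra
    also have "\<dots> = dilate 2 (euler 9 * e ^ 2)
      + fps_X * dilate 2 (3 * euler 9 * e * dilate 2 cubic_theta)"
      by (simp add: dilate_hom dilate_euler dilate_dilate)
    finally show ?thesis .
  qed
  hence J: "euler 3 ^ 2 * euler 1 ^ 3 * odd_part K = 3 * euler 9 * e * dilate 2 cubic_theta"
    by (rule odd_part_unique)
  have "dilate 2 (e * euler 1 ^ 2 * euler 6) = dilate 2 (euler 2 ^ 3 * euler 3 ^ 2)"
    using e(2) by (simp add: dilate_hom dilate_euler)
  hence e1: "e * euler 1 ^ 2 * euler 6 = euler 2 ^ 3 * euler 3 ^ 2"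
    by (rule dilate_inj[rotated]) simp
  have "(odd_part K * euler 1 ^ 5) * (euler 3 ^ 2 * euler 6 * euler 2)
      = (euler 3 ^ 2 * euler 1 ^ 3 * odd_part K) * euler 1 ^ 2 * euler 6 * euler 2"
    by algebra
  also have "\<dots> = 3 * euler 9 * (e * euler 1 ^ 2 * euler 6) * (dilate 2 cubic_theta * euler 2)"
    unfolding J by algebra
  also have "\<dots> = (3 * (euler 2 ^ 2 * euler 6 ^ 2 * euler 9)) * (euler 3 ^ 2 * euler 6 * euler 2)"
    using Dk[of 2] unfolding e1 by (simp add: eval_nat_numeral mult_ac)
  finally show ?thesis
    using nz[of 3] nz[of 6] nz[of 2] by (simp add: K_def)
qed

section \<open>Integrality\<close>

text \<open>Divisibility by 3 does not follow from a factor 3 over the rationals; the cofactor must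
  have integer coefficients.\<close>

definition integral_fps :: "rat fps \<Rightarrow> bool" where
  "integral_fps f \<longleftrightarrow> (\<forall>n. fps_nth f n \<in> \<int>)"

lemma integral_fps_mult: "integral_fps f \<Longrightarrow> integral_fps g \<Longrightarrow> integral_fps (f * g)"
  by (auto simp: integral_fps_def fps_mult_nth intro!: Ints_sum Ints_mult)

lemma integral_fps_one: "integral_fps 1"
  by (simp add: integral_fps_def)

lemma integral_fps_power: "integral_fps f \<Longrightarrow> integral_fps (f ^ k)"
  by (induction k) (auto intro: integral_fps_mult integral_fps_one)

lemma integral_fps_euler_f: "0 < k \<Longrightarrow> integral_fps (euler_f k)"
proof -
  assume k: "0 < k"
  have "integral_fps (\<Prod>j\<in>A. 1 - fps_X ^ (Suc j * k))" if "finite A" for A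
    using that
  proof (induction A rule: finite_induct)
    case (insert j A)
    have "integral_fps (1 - fps_X ^ (Suc j * k))"
      by (simp add: integral_fps_def fps_X_power_iff del: mult_Suc)
    thus ?case
      using insert by (simp del: mult_Suc add: integral_fps_mult)
  qed (simp add: integral_fps_one)
  thus ?thesis
    using k by (simp add: integral_fps_def euler_f_nth del: mult_Suc)
qed

text \<open>As \<open>u\<close> has constant term 1, each coefficient of \<open>g\<close> is
  determined by earlier ones without division.\<close>

lemma integral_fps_quotient:
  assumes "integral_fps (g * u)" "integral_fps u" "fps_nth u 0 = 1"
  shows "integral_fps g"
proof -
  have "fps_nth g n \<in> \<int>" for n
  proof (induction n rule: less_induct)
    case (less n)
    have "fps_nth (g * u) n = (\<Sum>i<n. fps_nth g i * fps_nth u (n - i)) + fps_nth g n"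
      using assms(3) by (simp add: fps_mult_nth atLeast0AtMost flip: lessThan_Suc_atMost)
    hence "fps_nth g n = fps_nth (g * u) n - (\<Sum>i<n. fps_nth g i * fps_nth u (n - i))"
      by simp
    also have "\<dots> \<in> \<int>"
      using assms less by (auto simp: integral_fps_def intro!: Ints_diff Ints_sum Ints_mult)
    finally show ?case .
  qed
  thus ?thesis by (simp add: integral_fps_def)
qed

theorem theorem1p7:
  shows "Abs_fps (\<lambda>n. of_nat (b_reg 9 (4 * n + 3)))
      = 3 * (euler_f 2 ^ 2 * euler_f 6 ^ 2 * euler_f 9 / euler_f 1 ^ 5)
      \<and> (\<forall>n. [b_reg 9 (4 * n + 3) = 0] (mod 3))"
proof -
  define B :: "rat fps" where "B = Abs_fps (\<lambda>n. of_nat (b_reg 9 (4 * n + 3)))"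
  define Y where "Y = euler_f 2 ^ 2 * euler_f 6 ^ 2 * euler_f 9"
  define u where "u = euler_f 1 ^ 5"
  have u0: "fps_nth u 0 = 1"
    by (simp add: u_def euler_f_nth_0 fps_nth_power_0)
  \<comment> \<open>Taking the odd part twice selects the indices \<open>4 * n + 3\<close>.\<close>
  have "2 * (2 * n + 1) + 1 = 4 * n + 3" for n :: nat
    by simp
  hence "odd_part (odd_part (Abs_fps (\<lambda>n. of_nat (b_reg 9 n)))) = fps_of_rat B"
    by (simp only: fps_eq_iff odd_part_def B_def fps_nth_Abs_fps fps_of_rat_nth of_rat_of_nat_eq) simp
  hence "fps_of_rat (B * u) = fps_of_rat (3 * Y)"
    using odd_odd_part_regular_9[OF regular_partitions_fps[of 9]]
    by (simp add: euler_def u_def Y_def fps_of_rat_hom fps_of_rat_power)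
  hence Bu: "B * u = 3 * Y"
    by (rule fps_of_rat_inj)
  have div: "Y / u * u = Y"
    using u0 by (simp add: fps_divide_unit inverse_mult_eq_1 mult.assoc)
  have "B * u = 3 * (Y / u) * u"
    unfolding Bu mult.assoc div ..
  moreover have "u \<noteq> 0"
    using u0 by auto
  ultimately have B: "B = 3 * (Y / u)"
    by simp
  have "integral_fps (Y / u)"
  proof (rule integral_fps_quotient)
    show "integral_fps (Y / u * u)" "integral_fps u"
      unfolding div unfolding Y_def u_def
      by (intro integral_fps_mult integral_fps_power integral_fps_euler_f; simp)+
  qed (rule u0)
  have "[b_reg 9 (4 * n + 3) = 0] (mod 3)" for n
  proof -
    obtain z where "fps_nth (Y / u) n = of_int z"
      using \<open>integral_fps (Y / u)\<close> unfolding integral_fps_def by (meson Ints_cases)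
    hence "of_int (int (b_reg 9 (4 * n + 3))) = (of_int (3 * z) :: rat)"
      using arg_cong[OF B, of "\<lambda>f. fps_nth f n"]
      by (simp add: B_def numeral_fps_const)
    hence "int (b_reg 9 (4 * n + 3)) = 3 * z"
      by (simp only: of_int_eq_iff)
    hence "3 dvd b_reg 9 (4 * n + 3)"
      by presburger
    thus ?thesis
      by (simp add: cong_0_iff)
  qed
  thus ?thesis
    using B unfolding B_def Y_def u_def by blast
qed

end
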